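(* Let $d,n\in\mathbb{N}$ (positive integers). The map $\Psi_{d,n}\colon\mathbb{P}_{d,n}\to\mathbb{X}_{d,n}$, $\Psi_{d,n}(P)=\sigma_J\big(PM_z|_{PH^2_d}\big)$, is surjective and continuous.
   Context: $\mathbb{B}_d$ is the open unit ball of $\mathbb{C}^d$. The Drury-Arveson space $H^2_d$ is the reproducing kernel Hilbert space of holomorphic functions on $\mathbb{B}_d$ with kernel $k(z,w)=\frac{1}{1-\langle z,w\rangle}$. $\mathcal{M}_d$ is its multiplier algebra, $M_f$ is multiplication by $f\in\mathcal{M}_d$, and $M_z=(M_{z_1},\dots,M_{z_d})$. $\mathbb{P}_{d,n}\subset B(H^2_d)$ is the set of orthogonal projections $P$ with $\dim(PH^2_d)=n$ and $PM_f^*P=M_f^*P$ for all $f\in\mathcal{M}_d$, with the operator norm topology. $PM_z|_{PH^2_d}$ denotes the commuting tuple $(PM_{z_1}|_{PH^2_d},\dots,PM_{z_d}|_{PH^2_d})$ on the $n$-dimensional space $PH^2_d$; it is jointly similar to a strict row contraction. The symmetrized polyball $\mathbb{X}_{d,n}=\mathbb{B}_d^n/S_n$ is the set of multisets of $n$ points of $\mathbb{B}_d$, written as formal sums $\sum_jm_j[\lambda_j]$ with $m_j\ge0$, $\sum_jm_j=n$, with the symmetric distance $d_s([X],[Y])=\min_{\sigma\in S_n}\max_{1\le j\le n}d_{ph}(x_j,y_{\sigma(j)})$ for $X=(x_j)$, $Y=(y_j)$, where the pseudohyperbolic distance $d_{ph}$ on $\mathbb{B}_d$ is given by $d_{ph}(z,w)^2=1-\frac{(1-\|z\|^2)(1-\|w\|^2)}{|1-\langle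 z,w\rangle|^2}$. For a commuting $d$-tuple $A$ of operators on an $n$-dimensional space, $\sigma(A)=\{\lambda\in\mathbb{C}^d:\bigcap_j\ker(A_j-\lambda_jI)\ne\{0\}\}$, $R_\lambda(A)=\bigcap_{|\alpha|=n}\ker(A-\lambda I)^\alpha$ (with $(A-\lambda I)^\alpha=\prod_j(A_j-\lambda_jI)^{\alpha_j}$), and, if $A$ is jointly similar to a strict row contraction (so $\sigma(A)\subset\mathbb{B}_d$), $\sigma_J(A)=\sum_{\lambda\in\sigma(A)}\dim R_\lambda(A)\,[\lambda]\in\mathbb{X}_{d,n}$. *)

theory Defs
  imports "HOL-Analysis.Analysis" "HOL-Library.Multiset" "HOL-Combinatorics.Permutations"
begin

text \<open>Complex Hilbert spaces. The real inner product, and hence the norm, the metric and the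
  operator norm of \<^typ>\<open>'a \<Rightarrow>\<^sub>L 'a\<close>, are those given by the real part of the complex inner product,
  which is linear in its first argument.\<close>

class complex_inner = real_inner +
  fixes scaleC :: "complex \<Rightarrow> 'a \<Rightarrow> 'a" (infixr "*\<^sub>C" 75)
    and cinner :: "'a \<Rightarrow> 'a \<Rightarrow> complex"
  assumes scaleC_add_right: "c *\<^sub>C (x + y) = c *\<^sub>C x + c *\<^sub>C y"
    and scaleC_add_left: "(c + c') *\<^sub>C x = c *\<^sub>C x + c' *\<^sub>C x"
    and scaleC_scaleC: "c *\<^sub>C c' *\<^sub>C x = (c * c') *\<^sub>C x"
    and scaleR_scaleC: "scaleR r x = complex_of_real r *\<^sub>C x"
    and cinner_commute: "cinner x y = cnj (cinner y x)"
    and cinner_add_left: "cinner (x + y) z = cinner x z + cinner y z"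
    and cinner_scaleC_left: "cinner (c *\<^sub>C x) y = c * cinner x y"
    and inner_eq_Re_cinner: "inner x y = Re (cinner x y)"

class complex_hilbert = complex_inner + complete_space

lemma scaleC_one: "1 *\<^sub>C x = (x::'a::complex_inner)"
  using scaleR_scaleC[of 1 x] by simp

global_interpretation complex_vector: vector_space "scaleC :: complex \<Rightarrow> 'a \<Rightarrow> 'a::complex_inner"
  defines cdim = complex_vector.dim
  by unfold_locales (simp_all add: scaleC_add_right scaleC_add_left scaleC_scaleC scaleC_one)

definition cadjoint :: "('a::complex_inner \<Rightarrow> 'a) \<Rightarrow> 'a \<Rightarrow> 'a" where
  "cadjoint T = (THE S. \<forall>x y. cinner (T x) y = cinner x (S y))"

text \<open>The ball \<open>ball 0 1\<close> of \<^typ>\<open>complex^'d\<close> is the Euclidean unit ball, since the norm of a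
  vector is the \<open>\<ell>\<^sup>2\<close> norm of its coordinates.\<close>

definition cdot :: "complex^'d \<Rightarrow> complex^'d \<Rightarrow> complex" where
  "cdot z w = (\<Sum>j\<in>UNIV. z $ j * cnj (w $ j))"

definition holomorphic_several :: "(complex^'d \<Rightarrow> complex) \<Rightarrow> (complex^'d) set \<Rightarrow> bool" where
  "holomorphic_several f U \<longleftrightarrow>
    (\<forall>z\<in>U. \<exists>L. (f has_derivative L) (at z) \<and> (\<forall>c v. L (c *s v) = c * L v))"

text \<open>The elements of a reproducing kernel Hilbert space on \<open>X\<close> form the Hilbert space
  \<^typ>\<open>'h\<close>, and \<open>ev f\<close> is the function on \<open>X\<close> that \<open>f\<close> stands for. The values of \<open>ev f\<close>
  outside \<open>X\<close> are irrelevant.\<close>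

definition rkhs :: "'x set \<Rightarrow> ('x \<Rightarrow> 'x \<Rightarrow> complex) \<Rightarrow> ('h::complex_hilbert \<Rightarrow> 'x \<Rightarrow> complex) \<Rightarrow> bool" where
  "rkhs X k ev \<longleftrightarrow>
    (\<forall>f g. \<forall>x\<in>X. ev (f + g) x = ev f x + ev g x) \<and>
    (\<forall>c f. \<forall>x\<in>X. ev (c *\<^sub>C f) x = c * ev f x) \<and>
    (\<forall>f g. (\<forall>x\<in>X. ev f x = ev g x) \<longrightarrow> f = g) \<and>
    (\<forall>w\<in>X. \<exists>kw. (\<forall>z\<in>X. ev kw z = k z w) \<and> (\<forall>f. ev f w = cinner f kw))"

definition drury_arveson :: "('h::complex_hilbert \<Rightarrow> complex^'d \<Rightarrow> complex) \<Rightarrow> bool" where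
  "drury_arveson ev \<longleftrightarrow>
    rkhs (ball 0 1) (\<lambda>z w. 1 / (1 - cdot z w)) ev \<and>
    (\<forall>f. holomorphic_several (ev f) (ball 0 1))"

definition multiplier :: "('h::complex_hilbert \<Rightarrow> complex^'d \<Rightarrow> complex) \<Rightarrow> (complex^'d \<Rightarrow> complex) \<Rightarrow> bool" where
  "multiplier ev f \<longleftrightarrow> (\<forall>h. \<exists>g. \<forall>z\<in>ball 0 1. ev g z = f z * ev h z)"

definition mult_op :: "('h::complex_hilbert \<Rightarrow> complex^'d \<Rightarrow> complex) \<Rightarrow> (complex^'d \<Rightarrow> complex) \<Rightarrow> 'h \<Rightarrow> 'h" where
  "mult_op ev f h = (THE g. \<forall>z\<in>ball 0 1. ev g z = f z * ev h z)"

definition orthogonal_projection :: "('h::complex_hilbert \<Rightarrow>\<^sub>L 'h) \<Rightarrow> bool" where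
  "orthogonal_projection P \<longleftrightarrow>
    (\<forall>c x. P (c *\<^sub>C x) = c *\<^sub>C P x) \<and>
    (\<forall>x. P (P x) = P x) \<and>
    (\<forall>x y. cinner (P x) y = cinner x (P y))"

definition coinvariant_projections ::
  "('h::complex_hilbert \<Rightarrow> complex^'d \<Rightarrow> complex) \<Rightarrow> nat \<Rightarrow> ('h \<Rightarrow>\<^sub>L 'h) set" where
  "coinvariant_projections ev n =
    {P. orthogonal_projection P \<and> cdim (range P) = n \<and>
        (\<forall>f. multiplier ev f \<longrightarrow>
          (\<forall>x. P (cadjoint (mult_op ev f) (P x)) = cadjoint (mult_op ev f) (P x)))}"

text \<open>A tuple of operators on a subspace \<open>V\<close> is a family \<open>A\<close> of maps, indexed by the coordinates,
  that send \<open>V\<close> to itself; only the values on \<open>V\<close> matter.\<close>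

definition compressed_shift ::
  "('h::complex_hilbert \<Rightarrow> complex^'d \<Rightarrow> complex) \<Rightarrow> ('h \<Rightarrow>\<^sub>L 'h) \<Rightarrow> 'd \<Rightarrow> 'h \<Rightarrow> 'h" where
  "compressed_shift ev P j v = P (mult_op ev (\<lambda>z. z $ j) v)"

definition joint_spectrum :: "'h::complex_hilbert set \<Rightarrow> ('d \<Rightarrow> 'h \<Rightarrow> 'h) \<Rightarrow> (complex^'d) set" where
  "joint_spectrum V A = {\<mu>. {v\<in>V. \<forall>j. A j v - (\<mu> $ j) *\<^sub>C v = 0} \<noteq> {0}}"

text \<open>The product of the powers \<open>B j ^^ \<alpha> j\<close>, in the order of some enumeration of the coordinates.
  The order is immaterial for commuting tuples.\<close>

definition multi_power :: "('d::finite \<Rightarrow> 'h \<Rightarrow> 'h) \<Rightarrow> ('d \<Rightarrow> nat) \<Rightarrow> 'h \<Rightarrow> 'h" where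
  "multi_power B \<alpha> =
    foldr (\<lambda>j T. (B j ^^ \<alpha> j) \<circ> T) (SOME js. distinct js \<and> set js = UNIV) id"

definition root_space :: "'h::complex_hilbert set \<Rightarrow> ('d::finite \<Rightarrow> 'h \<Rightarrow> 'h) \<Rightarrow> complex^'d \<Rightarrow> 'h set" where
  "root_space V A \<mu> =
    {v\<in>V. \<forall>\<alpha>. (\<Sum>j\<in>UNIV. \<alpha> j) = cdim V \<longrightarrow>
       multi_power (\<lambda>j x. A j x - (\<mu> $ j) *\<^sub>C x) \<alpha> v = 0}"

text \<open>Formal sums of points are multisets, with \<open>m[\<mu>]\<close> rendered as \<open>replicate_mset m \<mu>\<close>.\<close>

definition joint_spectrum_mset ::
  "'h::complex_hilbert set \<Rightarrow> ('d::finite \<Rightarrow> 'h \<Rightarrow> 'h) \<Rightarrow> (complex^'d) multiset" where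
  "joint_spectrum_mset V A =
    (\<Sum>\<mu>\<in>joint_spectrum V A. replicate_mset (cdim (root_space V A \<mu>)) \<mu>)"

definition Psi ::
  "('h::complex_hilbert \<Rightarrow> complex^'d \<Rightarrow> complex) \<Rightarrow> ('h \<Rightarrow>\<^sub>L 'h) \<Rightarrow> (complex^'d) multiset" where
  "Psi ev P = joint_spectrum_mset (range P) (compressed_shift ev P)"

definition pseudohyp_dist :: "complex^'d \<Rightarrow> complex^'d \<Rightarrow> real" where
  "pseudohyp_dist z w =
    sqrt (1 - (1 - (norm z)\<^sup>2) * (1 - (norm w)\<^sup>2) / (cmod (1 - cdot z w))\<^sup>2)"

definition sym_polyball :: "nat \<Rightarrow> (complex^'d) multiset set" where
  "sym_polyball n = {X. size X = n \<and> set_mset X \<subseteq> ball 0 1}"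

definition tuple_dist :: "(complex^'d) list \<Rightarrow> (complex^'d) list \<Rightarrow> real" where
  "tuple_dist xs ys =
    Min ((\<lambda>\<sigma>. Max ((\<lambda>j. pseudohyp_dist (xs ! j) (ys ! \<sigma> j)) ` {..<length xs}))
         ` {\<sigma>. \<sigma> permutes {..<length xs}})"

text \<open>For multisets of equal size the value does not depend on the chosen orderings.\<close>

definition sym_dist :: "(complex^'d) multiset \<Rightarrow> (complex^'d) multiset \<Rightarrow> real" where
  "sym_dist X Y = tuple_dist (SOME xs. mset xs = X) (SOME ys. mset ys = Y)"

text \<open>The metric topology of \<^const>\<open>sym_dist\<close>. The library's \<open>Metric_space.mtopology\<close> asks for a
  distance that is nonnegative and symmetric also off the carrier, which \<^const>\<open>sym_dist\<close> is not.\<close>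

definition sym_polyball_topology :: "nat \<Rightarrow> (complex^'d) multiset topology" where
  "sym_polyball_topology n =
    topology (\<lambda>U. U \<subseteq> sym_polyball n \<and>
      (\<forall>X\<in>U. \<exists>r>0. {Y\<in>sym_polyball n. sym_dist X Y < r} \<subseteq> U))"

lemma openin_sym_polyball_topology:
  fixes U :: "(complex^'d) multiset set"
  shows "openin (sym_polyball_topology n) U \<longleftrightarrow> U \<subseteq> sym_polyball n \<and>
    (\<forall>X\<in>U. \<exists>r>0. {Y\<in>sym_polyball n. sym_dist X Y < r} \<subseteq> U)"
proof -
  let ?op = "\<lambda>U::(complex^'d) multiset set. U \<subseteq> sym_polyball n \<and>
    (\<forall>X\<in>U. \<exists>r>0. {Y\<in>sym_polyball n. sym_dist X Y < r} \<subseteq> U)"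
  have "?op (S \<inter> T)" if S: "?op S" and T: "?op T" for S T
  proof (intro conjI ballI)
    show "S \<inter> T \<subseteq> sym_polyball n" using S by blast
    fix X assume X: "X \<in> S \<inter> T"
    then obtain r s where "r > 0" "{Y\<in>sym_polyball n. sym_dist X Y < r} \<subseteq> S"
      and "s > 0" "{Y\<in>sym_polyball n. sym_dist X Y < s} \<subseteq> T"
      using S T by (meson IntD1 IntD2)
    then show "\<exists>r>0. {Y\<in>sym_polyball n. sym_dist X Y < r} \<subseteq> S \<inter> T"
      by (intro exI[of _ "min r s"]) auto
  qed
  moreover have "?op (\<Union>\<K>)" if "\<forall>K\<in>\<K>. ?op K" for \<K>
    using that by (meson Sup_le_iff Union_upper UnionE subset_trans)
  ultimately have "istopology ?op"
    unfolding istopology_def by blast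
  then show ?thesis
    unfolding sym_polyball_topology_def by (simp only: topology_inverse')
qed

end

theory Submission
  imports Defs "HOL-Complex_Analysis.Cauchy_Integral_Formula"
    "HOL-Computational_Algebra.Fundamental_Theorem_Algebra"
begin

text \<open>
  Write \<open>M j\<close> for multiplication by the coordinate \<open>z $ j\<close>. Everything is read off from one kind of
  object: an orthonormal basis \<open>e\<^sub>0, \<dots>, e\<^sub>n\<^sub>-\<^sub>1\<close> of the range of \<open>P\<close> such that
  \<open>cinner (M j e\<^sub>i) e\<^sub>l = 0\<close> for \<open>i < l\<close> and all \<open>j\<close> (\<open>triangular\<close>). The compressions of the \<open>M j\<close> then have
  triangular matrices, and their diagonals make up \<open>n\<close> points \<open>\<mu>\<^sub>i\<close> of \<open>\<complex>\<^sup>d\<close>.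

  Coinvariance makes the compressions commute, so they have a common eigenvector, and Schur's argument
  gives such a basis (\<open>schur_triangularization\<close>). For commuting triangular tuples the joint spectrum
  with multiplicities is the multiset of the \<open>\<mu>\<^sub>i\<close> (\<open>joint_spectrum_mset_eq\<close>): the root space
  of \<open>\<mu>\<close> has a basis whose leading coordinates sit exactly at the indices \<open>i\<close> with \<open>\<mu>\<^sub>i = \<mu>\<close>. The points lie in
  the ball because the \<open>\<mu>\<^sub>i\<close> are also, up to conjugation, joint eigenvalues of the adjoints of the
  \<open>M j\<close>. A joint eigenvector \<open>v\<close> of those has the values \<open>c / (1 - \<langle>w, \<mu>\<rangle>)\<close>, by the identity
  \<open>k\<^sub>w = 1 + \<Sum>\<^sub>j cnj w\<^sub>j M\<^sub>j k\<^sub>w\<close>, and for \<open>\<parallel>\<mu>\<parallel> \<ge> 1\<close> this grows faster than \<open>\<parallel>v\<parallel> \<parallel>k\<^sub>w\<parallel>\<close> allows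
  (\<open>joint_eigenvalue_in_ball\<close>).

  Continuity: the condition \<open>triangular\<close> consists of equations between inner products in which \<open>P\<close>
  does not occur, so it survives limits. If \<open>Q k \<longlonglongrightarrow> P\<close>, the triangular bases of the ranges of
  \<open>Q k\<close> lie close to a finite-dimensional space and have a convergent subsequence. Its limit is a triangular
  basis for \<open>P\<close>, and the diagonals converge to its diagonal (\<open>triangular_limit\<close>). Contradiction with a
  sequence that stays away from \<open>\<Psi>(P)\<close> gives continuity.

  Surjectivity: the prescribed points are added one at a time. Suppose that \<open>V\<close> is spanned by the basis so far,
  and that its orthogonal complement \<open>I\<close> is invariant under all multipliers. For a new point \<open>\<nu>\<close>
  restrict the functions in \<open>I\<close> to a line \<open>\<nu> + t e\<^sub>j\<close>. They do not all vanish there, since \<open>V\<close> contains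
  kernel functions for only finitely many points of the line. Let \<open>m\<close> be the smallest order of vanishing at
  \<open>t = 0\<close>. Then \<open>L h = lim h(\<nu> + t e\<^sub>j) / t\<^sup>m\<close> is a nonzero bounded functional on \<open>I\<close> with
  \<open>L (f h) = f(\<nu>) L h\<close> for every multiplier \<open>f\<close>. The vector of \<open>I\<close> that represents \<open>L\<close>,
  normalized, extends the basis (\<open>extension_vector\<close>). When \<open>\<nu>\<close> occurs for the first time, this adds the
  kernel function at \<open>\<nu>\<close>; repetitions add derivatives, which need not be written down.

  The adjoint of a multiplication operator is defined by a description, so its existence has to be
  established for all multipliers: coordinate functions are multipliers because \<open>(1 - \<langle>z, w\<rangle>) k(z, w) = 1\<close>
  (\<open>multiplier_coord\<close>), and all multiplication operators are bounded by the uniform boundedness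
  principle (\<open>multiplier_bounded\<close>).
\<close>

section \<open>Complex inner products and linear maps\<close>

abbreviation csubspace :: "'h::complex_inner set \<Rightarrow> bool" where
  "csubspace \<equiv> complex_vector.subspace"

abbreviation cspan :: "'h::complex_inner set \<Rightarrow> 'h set" where
  "cspan \<equiv> complex_vector.span"

definition clinear :: "('h::complex_inner \<Rightarrow> 'h) \<Rightarrow> bool" where
  "clinear T \<longleftrightarrow> (\<forall>x y. T (x + y) = T x + T y) \<and> (\<forall>c x. T (c *\<^sub>C x) = c *\<^sub>C T x)"

lemma clinear_add: "clinear T \<Longrightarrow> T (x + y) = T x + T y"
  and clinear_scaleC: "clinear T \<Longrightarrow> T (c *\<^sub>C x) = c *\<^sub>C T x"
  by (auto simp: clinear_def)

lemma scaleC_minus_one: "(-1) *\<^sub>C x = - (x::'a::complex_inner)"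
  using complex_vector.scale_minus_left[of 1 x] by (simp add: scaleC_one)

lemma clinear_zero: "clinear T \<Longrightarrow> T 0 = 0"
  using clinear_add[of T 0 0] by simp

lemma clinear_minus: "clinear T \<Longrightarrow> T (- x) = - T x"
  using clinear_scaleC[of T "-1" x] by (simp add: scaleC_minus_one)

lemma clinear_diff: "clinear T \<Longrightarrow> T (x - y) = T x - T y"
  using clinear_add[of T x "- y"] by (simp add: clinear_minus)

lemma clinear_sum: "clinear T \<Longrightarrow> T (sum f S) = (\<Sum>i\<in>S. T (f i))"
  by (induction S rule: infinite_finite_induct) (auto simp: clinear_zero clinear_add)

lemma clinear_range_subspace: "clinear T \<Longrightarrow> csubspace (range T)"
  unfolding complex_vector.subspace_def
  by (metis (no_types, lifting) clinear_add clinear_scaleC clinear_zero rangeE rangeI)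

lemma cinner_zero_left [simp]: "cinner 0 y = 0"
  using cinner_add_left[of 0 0 y] by simp

lemma cinner_minus_left [simp]: "cinner (- x) y = - cinner x y"
  using cinner_scaleC_left[of "-1" x y] by (simp add: scaleC_minus_one)

lemma cinner_diff_left: "cinner (x - y) z = cinner x z - cinner y z"
  using cinner_add_left[of x "- y" z] by simp

lemma cinner_add_right: "cinner x (y + z) = cinner x y + cinner x z"
  by (metis cinner_add_left cinner_commute complex_cnj_add)

lemma cinner_zero_right [simp]: "cinner y 0 = 0"
  using cinner_add_right[of y 0 0] by simp

lemma cinner_scaleC_right: "cinner x (c *\<^sub>C y) = cnj c * cinner x y"
  by (metis cinner_commute cinner_scaleC_left complex_cnj_mult complex_cnj_cnj)

lemma cinner_diff_right: "cinner x (y - z) = cinner x y - cinner x z"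
  by (metis cinner_commute cinner_diff_left complex_cnj_diff)

lemma cinner_sum_left: "cinner (sum f S) y = (\<Sum>i\<in>S. cinner (f i) y)"
  by (induction S rule: infinite_finite_induct) (auto simp: cinner_add_left)

lemma cinner_sum_right: "cinner y (sum f S) = (\<Sum>i\<in>S. cinner y (f i))"
  by (induction S rule: infinite_finite_induct) (auto simp: cinner_add_right)

lemmas cinner_simps = cinner_add_left cinner_add_right cinner_scaleC_left cinner_scaleC_right
  cinner_diff_left cinner_diff_right cinner_sum_left cinner_sum_right

lemma cinner_self: "cinner x x = complex_of_real ((norm x)\<^sup>2)"
  using cinner_commute[of x x] inner_eq_Re_cinner[of x x]
  by (auto simp: complex_eq_iff power2_norm_eq_inner)

lemma cinner_self_eq_0 [simp]: "cinner x x = 0 \<longleftrightarrow> x = 0"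
  by (simp add: cinner_self)

lemma norm_scaleC: "norm (c *\<^sub>C x) = cmod c * norm (x::'a::complex_inner)"
proof -
  have "complex_of_real ((norm (c *\<^sub>C x))\<^sup>2) = complex_of_real ((cmod c * norm x)\<^sup>2)"
    by (simp only: cinner_self[symmetric] cinner_simps mult.assoc[symmetric])
       (simp add: cinner_self complex_norm_square power_mult_distrib flip: of_real_power)
  then show ?thesis
    by (simp only: of_real_eq_iff power2_eq_iff_nonneg norm_ge_zero mult_nonneg_nonneg)
qed

text \<open>Rotating \<open>y\<close> by a unimodular scalar makes the complex inner product real, which reduces
  the inequality to the one for the real inner product.\<close>

lemma norm_cinner_le: "cmod (cinner x y) \<le> norm x * norm (y::'a::complex_inner)"
proof (cases "cinner x y = 0")
  case False
  define c where "c = cinner x y / cmod (cinner x y)"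
  have c: "cmod c = 1" using False by (simp add: c_def norm_divide)
  have "cnj (cinner x y) * cinner x y = complex_of_real ((cmod (cinner x y))\<^sup>2)"
    by (subst complex_norm_square) (simp add: mult.commute)
  then have "cinner x (c *\<^sub>C y) = cmod (cinner x y)"
    using False by (simp add: c_def cinner_simps power2_eq_square)
  then have "cmod (cinner x y) = inner x (c *\<^sub>C y)" by (simp add: inner_eq_Re_cinner)
  also have "\<dots> \<le> norm x * norm (c *\<^sub>C y)" by (rule norm_cauchy_schwarz)
  finally show ?thesis using c by (simp add: norm_scaleC)
qed simp

lemma bounded_bilinear_cinner: "bounded_bilinear (cinner :: 'a::complex_inner \<Rightarrow> 'a \<Rightarrow> complex)"
proof
  show "\<exists>K. \<forall>a b::'a. cmod (cinner a b) \<le> norm a * norm b * K"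
    by (rule exI[of _ 1]) (simp add: norm_cinner_le)
qed (auto simp: cinner_simps scaleR_scaleC scaleR_conv_of_real)

lemma bounded_bilinear_scaleC: "bounded_bilinear (scaleC :: complex \<Rightarrow> 'a::complex_inner \<Rightarrow> 'a)"
proof
  show "\<exists>K. \<forall>a. \<forall>b::'a. norm (a *\<^sub>C b) \<le> norm a * norm b * K"
    by (rule exI[of _ 1]) (simp add: norm_scaleC)
qed (auto simp: scaleC_add_left scaleC_add_right scaleR_scaleC scaleC_scaleC scaleR_conv_of_real
    mult.commute)

lemmas tendsto_cinner = bounded_bilinear.tendsto[OF bounded_bilinear_cinner]
lemmas tendsto_scaleC = bounded_bilinear.tendsto[OF bounded_bilinear_scaleC]

lemma cinner_eqI: "(\<And>x. cinner x y = cinner x z) \<Longrightarrow> y = z"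
  using cinner_self_eq_0[of "y - z"] by (simp only: cinner_diff_right) simp

lemma cinner_eqI_left: "(\<And>x. cinner y x = cinner z x) \<Longrightarrow> y = z"
  using cinner_self_eq_0[of "y - z"] by (simp only: cinner_diff_left) simp

lemma cinner_eq_0_commute: "cinner x y = 0 \<longleftrightarrow> cinner y x = 0"
  by (metis cinner_commute complex_cnj_zero)

lemma cadjoint_eqI:
  assumes "\<And>x y. cinner (T x) y = cinner x (S y)"
  shows "cadjoint T = S"
  unfolding cadjoint_def
proof (rule the_equality)
  fix S' assume "\<forall>x y. cinner (T x) y = cinner x (S' y)"
  then show "S' = S" using assms by (intro ext cinner_eqI) metis
qed (use assms in blast)

lemma bounded_linear_clinear:
  assumes T: "clinear T" and "\<And>x. norm (T x) \<le> C * norm x"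
  shows "bounded_linear T"
  by (rule bounded_linear_intro[of _ C])
     (use assms in \<open>auto simp: clinear_add scaleR_scaleC clinear_scaleC mult.commute\<close>)

section \<open>Riesz representation and uniform boundedness\<close>

text \<open>The functional is given by its graph, a subspace of \<open>H \<times> \<real>\<close>; the bound makes the graph
single-valued, so functionals on formal linear combinations need no separate proof of being
well defined. The representing vector is the limit of a minimizing sequence for \<open>\<parallel>x\<parallel>\<^sup>2 - 2 t\<close>, which
is Cauchy by the parallelogram law.\<close>

lemma riesz_graph:
  fixes S :: "('h::{real_inner, complete_space} \<times> real) set"
  assumes S: "subspace S" and C: "C \<ge> 0" and bd: "\<And>x t. (x, t) \<in> S \<Longrightarrow> \<bar>t\<bar> \<le> C * norm x"
  obtains g where "norm g \<le> C" "\<And>x t. (x, t) \<in> S \<Longrightarrow> t = inner x g"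
proof -
  define F where "F = (\<lambda>p::'h \<times> real. (norm (fst p))\<^sup>2 - 2 * snd p)"
  have Fge: "F p \<ge> - (C\<^sup>2)" if "p \<in> S" for p
  proof -
    have "\<bar>snd p\<bar> \<le> C * norm (fst p)" using bd[of "fst p" "snd p"] that by simp
    moreover have "0 \<le> (norm (fst p) - C)\<^sup>2" by simp
    ultimately show ?thesis by (simp add: F_def power2_diff algebra_simps)
  qed
  have ne: "F ` S \<noteq> {}" using subspace_0[OF S] by blast
  have bdd: "bdd_below (F ` S)" using Fge by (intro bdd_belowI2)
  define D where "D = Inf (F ` S)"
  have Dle: "D \<le> F p" if "p \<in> S" for p unfolding D_def using that bdd by (intro cInf_lower) auto
  have "\<exists>p\<in>S. F p < D + 1 / Suc k" for k
    using cInf_lessD[OF ne, of "D + 1 / Suc k"] by (auto simp: D_def)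
  then obtain s where s: "\<And>k. s k \<in> S" "\<And>k. F (s k) < D + 1 / Suc k" by metis
  have Flim: "(\<lambda>k. F (s k)) \<longlonglongrightarrow> D"
  proof (rule tendsto_sandwich[of "\<lambda>_. D" _ _ "\<lambda>k. D + 1 / Suc k"])
    show "(\<lambda>k. D + 1 / Suc k) \<longlonglongrightarrow> D"
      using tendsto_add[OF tendsto_const LIMSEQ_inverse_real_of_nat, of D]
      by (simp add: inverse_eq_divide)
  qed (use Dle s in \<open>auto intro!: always_eventually less_imp_le simp del: of_nat_Suc\<close>)
  have par: "(norm (fst p - fst q))\<^sup>2 \<le> 2 * (F p - D) + 2 * (F q - D)" if "p \<in> S" "q \<in> S" for p q
  proof -
    have "(1/2) *\<^sub>R (p + q) \<in> S" using S that by (intro subspace_scale subspace_add)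
    then have "D \<le> F ((1/2) *\<^sub>R (p + q))" by (rule Dle)
    also have "\<dots> = (F p + F q) / 2 - (norm (fst p - fst q))\<^sup>2 / 4"
      by (simp add: F_def power2_norm_eq_inner inner_simps inner_commute field_simps)
    finally show ?thesis by (simp add: field_simps)
  qed
  have "Cauchy (\<lambda>k. fst (s k))"
  proof (rule metric_CauchyI)
    fix e :: real assume e: "e > 0"
    then have "eventually (\<lambda>k. F (s k) < D + e\<^sup>2 / 4) sequentially"
      by (intro order_tendstoD[OF Flim]) simp
    then obtain M where M: "\<And>k. k \<ge> M \<Longrightarrow> F (s k) < D + e\<^sup>2 / 4"
      by (auto simp: eventually_sequentially)
    have "dist (fst (s i)) (fst (s j)) < e" if "i \<ge> M" "j \<ge> M" for i j
    proof -
      have "(norm (fst (s i) - fst (s j)))\<^sup>2 < e\<^sup>2"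
        using par[OF s(1) s(1), of i j] M[OF that(1)] M[OF that(2)] by simp
      then show ?thesis using e by (simp add: dist_norm power2_less_imp_less)
    qed
    then show "\<exists>M. \<forall>i\<ge>M. \<forall>j\<ge>M. dist (fst (s i)) (fst (s j)) < e" by blast
  qed
  then obtain g where g: "(\<lambda>k. fst (s k)) \<longlonglongrightarrow> g"
    using Cauchy_convergent_iff convergent_def by blast
  have eq: "t = inner x g" if xt: "(x, t) \<in> S" for x t
  proof -
    \<comment> \<open>Minimality along the line through \<open>(x, t)\<close> gives a quadratic in \<open>r\<close> without constant term that
      is nowhere negative, so its linear coefficient \<open>2 b\<close> must vanish.\<close>
    define b where "b = inner g x - t"
    have q: "0 \<le> 2 * r * b + r\<^sup>2 * (norm x)\<^sup>2" for r
    proof -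
      have "(\<lambda>k. F (s k) + 2 * r * (inner (fst (s k)) x - t) + r\<^sup>2 * (norm x)\<^sup>2)
          \<longlonglongrightarrow> D + 2 * r * (inner g x - t) + r\<^sup>2 * (norm x)\<^sup>2"
        by (intro tendsto_intros Flim g)
      moreover have "D \<le> F (s k) + 2 * r * (inner (fst (s k)) x - t) + r\<^sup>2 * (norm x)\<^sup>2" for k
      proof -
        have "D \<le> F (s k + r *\<^sub>R (x, t))"
          using S s xt by (intro Dle subspace_scale subspace_add)
        also have "\<dots> = F (s k) + 2 * r * (inner (fst (s k)) x - t) + r\<^sup>2 * (norm x)\<^sup>2"
          by (simp add: F_def power2_norm_eq_inner inner_simps inner_commute)
             (simp add: power2_eq_square algebra_simps)
        finally show ?thesis .
      qed
      ultimately have "D \<le> D + 2 * r * (inner g x - t) + r\<^sup>2 * (norm x)\<^sup>2"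
        by (intro LIMSEQ_le_const) auto
      then show ?thesis by (simp add: b_def)
    qed
    define a where "a = (norm x)\<^sup>2"
    have a: "a \<ge> 0" by (simp add: a_def)
    \<comment> \<open>The minimizer \<open>- b / a\<close> of the quadratic is perturbed to \<open>- b / (a + 1)\<close> to cover \<open>a = 0\<close>.\<close>
    have "0 \<le> 2 * (- b / (a + 1)) * b + (- b / (a + 1))\<^sup>2 * a" unfolding a_def by (rule q)
    also have "\<dots> = - (b\<^sup>2) * (a + 2) / (a + 1)\<^sup>2"
      using a by (simp add: power2_eq_square divide_simps add_nonneg_eq_0_iff) (simp add: algebra_simps)
    finally have "b\<^sup>2 * (a + 2) \<le> 0"
      using a by (simp add: divide_simps power2_eq_square split: if_splits)
    then have "b = 0" using a by (simp add: mult_le_0_iff)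
    then show ?thesis by (simp add: b_def inner_commute)
  qed
  have "norm g \<le> C"
  proof -
    have "(\<lambda>k. inner (fst (s k)) g) \<longlonglongrightarrow> inner g g" "(\<lambda>k. C * norm (fst (s k))) \<longlonglongrightarrow> C * norm g"
      by (intro tendsto_intros g)+
    moreover have "inner (fst (s k)) g \<le> C * norm (fst (s k))" for k
      using bd[of "fst (s k)" "snd (s k)"] eq[of "fst (s k)" "snd (s k)"] s(1)[of k] by simp
    ultimately have "inner g g \<le> C * norm g" by (intro LIMSEQ_le) auto
    then have "norm g * norm g \<le> C * norm g"
      by (simp add: power2_norm_eq_inner[symmetric] power2_eq_square)
    then show ?thesis using C by (cases "g = 0") auto
  qed
  then show thesis using eq that by blast
qed

text \<open>A complex-linear functional is determined by its real part, which has a representing vector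
for the real inner product.\<close>

lemma riesz_csubspace:
  fixes D :: "'h::complex_hilbert set"
  assumes D: "csubspace D" and C: "C \<ge> 0"
    and add: "\<And>x y. x \<in> D \<Longrightarrow> y \<in> D \<Longrightarrow> \<phi> (x + y) = \<phi> x + \<phi> y"
    and scale: "\<And>c x. x \<in> D \<Longrightarrow> \<phi> (c *\<^sub>C x) = c * \<phi> x"
    and bd: "\<And>x. x \<in> D \<Longrightarrow> cmod (\<phi> x) \<le> C * norm x"
  obtains g where "norm g \<le> C" "\<And>x. x \<in> D \<Longrightarrow> \<phi> x = cinner x g"
proof -
  define S where "S = (\<lambda>x. (x, Re (\<phi> x))) ` D"
  have "subspace S"
    unfolding subspace_def S_def
  proof (intro conjI ballI allI)
    have "\<phi> 0 = 0" using scale[of 0 0] complex_vector.subspace_0[OF D] by simp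
    then show "0 \<in> (\<lambda>x. (x, Re (\<phi> x))) ` D"
      using complex_vector.subspace_0[OF D] by (auto simp: image_iff zero_prod_def intro!: bexI[of _ 0])
  next
    fix p q assume "p \<in> (\<lambda>x. (x, Re (\<phi> x))) ` D" "q \<in> (\<lambda>x. (x, Re (\<phi> x))) ` D"
    then obtain x y where "x \<in> D" "y \<in> D" "p = (x, Re (\<phi> x))" "q = (y, Re (\<phi> y))" by blast
    then show "p + q \<in> (\<lambda>x. (x, Re (\<phi> x))) ` D" using D
      by (auto simp: image_iff add intro!: bexI[of _ "x + y"] complex_vector.subspace_add)
  next
    fix c p assume "p \<in> (\<lambda>x. (x, Re (\<phi> x))) ` D"
    then obtain x where "x \<in> D" "p = (x, Re (\<phi> x))" by blast
    then show "c *\<^sub>R p \<in> (\<lambda>x. (x, Re (\<phi> x))) ` D" using D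
      by (auto simp: image_iff scaleR_scaleC scale
          intro!: bexI[of _ "complex_of_real c *\<^sub>C x"] complex_vector.subspace_scale)
  qed
  moreover have "\<bar>t\<bar> \<le> C * norm x" if "(x, t) \<in> S" for x t
  proof -
    have "x \<in> D" "t = Re (\<phi> x)" using that by (auto simp: S_def)
    then show ?thesis using bd[of x] abs_Re_le_cmod[of "\<phi> x"] by simp
  qed
  ultimately obtain g where g: "norm g \<le> C" "\<And>x t. (x, t) \<in> S \<Longrightarrow> t = inner x g"
    using riesz_graph[OF _ C] by metis
  have Re: "Re (\<phi> x) = Re (cinner x g)" if "x \<in> D" for x
    using g(2)[of x "Re (\<phi> x)"] that by (auto simp: S_def inner_eq_Re_cinner)
  have "\<phi> x = cinner x g" if "x \<in> D" for x
  proof -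
    have "Re (\<phi> (\<i> *\<^sub>C x)) = Re (cinner (\<i> *\<^sub>C x) g)"
      using that D by (intro Re complex_vector.subspace_scale)
    then show ?thesis using Re[OF that] that by (simp add: scale cinner_simps complex_eq_iff)
  qed
  then show thesis using that g(1) by blast
qed

text \<open>The uniform boundedness principle, by Baire's theorem: the sets of vectors on which all of \<open>G\<close> is bounded by
\<open>k\<close> are closed and cover the space, so one of them contains a ball.\<close>

lemma weakly_bounded_imp_bounded:
  fixes G :: "'h::complex_hilbert set"
  assumes "\<And>x. \<exists>C. \<forall>g\<in>G. cmod (cinner x g) \<le> C"
  shows "\<exists>C\<ge>0. \<forall>g\<in>G. norm g \<le> C"
proof -
  define F where "F = (\<lambda>k::nat. {x::'h. \<forall>g\<in>G. cmod (cinner x g) \<le> k})"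
  have clF: "closed (F k)" for k
  proof -
    have "F k = (\<Inter>g\<in>G. {x. cmod (cinner x g) \<le> k})" by (auto simp: F_def)
    moreover have "closed {x. cmod (cinner x g) \<le> k}" for g :: 'h
      by (intro closed_Collect_le continuous_intros
          bounded_linear.continuous_on[OF bounded_bilinear.bounded_linear_left[OF bounded_bilinear_cinner]])
    ultimately show ?thesis by auto
  qed
  have "\<exists>k. interior (F k) \<noteq> {}"
  proof (rule ccontr)
    assume "\<not> ?thesis"
    then have int: "interior (F k) = {}" for k by blast
    have "Met_TC.mtopology interior_of \<Union>(range F) = {}"
    proof (rule Met_TC.metric_Baire_category_alt)
      show "Met_TC.mcomplete TYPE('h)"
        by (simp add: complete_UNIV)
    qed (use clF int in auto)
    moreover have "\<Union>(range F) = UNIV"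
    proof -
      have "x \<in> \<Union>(range F)" for x
      proof -
        obtain C where C: "\<forall>g\<in>G. cmod (cinner x g) \<le> C" using assms by blast
        then have "x \<in> F (nat \<lceil>C\<rceil>)" unfolding F_def by (auto intro: order_trans real_nat_ceiling_ge)
        then show ?thesis by blast
      qed
      then show ?thesis by blast
    qed
    ultimately show False by simp
  qed
  then obtain k x where "x \<in> interior (F k)" by blast
  then obtain r where r: "r > 0" "cball x r \<subseteq> F k"
    by (meson mem_interior_cball)
  have "norm g \<le> 2 * k / r" if g: "g \<in> G" for g
  proof (cases "g = 0")
    case False
    define y where "y = (r / norm g) *\<^sub>R g"
    have ny: "norm y = r" using False r by (simp add: y_def)
    have "cmod (cinner x g) \<le> k" "cmod (cinner (x + y) g) \<le> k"
      using r ny g by (auto simp: F_def subset_iff dist_norm)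
    moreover have "cinner y g = cinner (x + y) g - cinner x g" by (simp add: cinner_simps)
    ultimately have "cmod (cinner y g) \<le> 2 * k"
      using norm_triangle_ineq4[of "cinner (x + y) g" "cinner x g"] by simp
    moreover have "cinner y g = complex_of_real (r * norm g)"
      using False by (simp add: y_def scaleR_scaleC cinner_simps cinner_self power2_eq_square)
    ultimately show ?thesis using r by (simp add: field_simps norm_mult)
  qed (use r in simp)
  then show ?thesis using r by (intro exI[of _ "2 * k / r"]) auto
qed

section \<open>Orthonormal lists and orthogonal projections\<close>

definition orthonormal_list :: "'h::complex_inner list \<Rightarrow> bool" where
  "orthonormal_list es \<longleftrightarrow>
    (\<forall>i<length es. \<forall>l<length es. cinner (es ! i) (es ! l) = (if i = l then 1 else 0))"

definition list_proj :: "'h::complex_inner list \<Rightarrow> 'h \<Rightarrow> 'h" where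
  "list_proj es x = (\<Sum>i<length es. cinner x (es ! i) *\<^sub>C es ! i)"

definition orth_proj :: "('h::complex_inner \<Rightarrow> 'h) \<Rightarrow> bool" where
  "orth_proj P \<longleftrightarrow> clinear P \<and> (\<forall>x. P (P x) = P x) \<and> (\<forall>x y. cinner (P x) y = cinner x (P y))"

lemma orth_projD:
  assumes "orth_proj P"
  shows "clinear P" "P (P x) = P x" "cinner (P x) y = cinner x (P y)"
  using assms by (auto simp: orth_proj_def)

lemma orth_proj_fixes: "orth_proj P \<Longrightarrow> x \<in> range P \<Longrightarrow> P x = x"
  using orth_projD(2) by fastforce

lemma clinear_list_proj: "clinear (list_proj es)"
  by (auto simp: clinear_def list_proj_def cinner_simps complex_vector.scale_sum_right
      complex_vector.scale_left_distrib sum.distrib)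

lemma list_proj_in_span: "list_proj es x \<in> cspan (set es)"
  unfolding list_proj_def
  by (intro complex_vector.span_sum complex_vector.span_scale complex_vector.span_base) auto

lemma cinner_list_proj:
  assumes "orthonormal_list es" "l < length es"
  shows "cinner (list_proj es x) (es ! l) = cinner x (es ! l)"
proof -
  have "cinner (list_proj es x) (es ! l)
      = (\<Sum>i<length es. cinner x (es ! i) * cinner (es ! i) (es ! l))"
    by (simp add: list_proj_def cinner_simps)
  also have "\<dots> = (\<Sum>i<length es. if i = l then cinner x (es ! i) else 0)"
    using assms by (intro sum.cong) (auto simp: orthonormal_list_def)
  finally have "cinner (list_proj es x) (es ! l) = \<dots>" .
  then show ?thesis using assms(2) by simp
qed

lemma list_proj_fixes:
  assumes es: "orthonormal_list es" and x: "x \<in> cspan (set es)"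
  shows "list_proj es x = x"
  using x
proof (induction rule: complex_vector.span_induct)
  case base
  show "csubspace {x. list_proj es x = x}"
    by (auto simp: complex_vector.subspace_def clinear_add[OF clinear_list_proj]
        clinear_scaleC[OF clinear_list_proj] clinear_zero[OF clinear_list_proj])
next
  case (step x)
  then obtain l where l: "l < length es" "x = es ! l" by (auto simp: in_set_conv_nth)
  have "list_proj es x = (\<Sum>i<length es. if i = l then es ! i else 0)"
    unfolding list_proj_def using es l
    by (intro sum.cong) (auto simp: orthonormal_list_def scaleC_one)
  then show ?case using l by simp
qed

lemma orth_proj_list_proj:
  assumes "orthonormal_list es"
  shows "orth_proj (list_proj es)"
proof -
  have "cinner (list_proj es x) y = cinner x (list_proj es y)" for x y
    unfolding list_proj_def
    by (simp add: cinner_simps mult.commute flip: cinner_commute)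
  then show ?thesis
    by (simp add: orth_proj_def clinear_list_proj list_proj_fixes[OF assms] list_proj_in_span)
qed

lemma range_list_proj: "orthonormal_list es \<Longrightarrow> range (list_proj es) = cspan (set es)"
  using list_proj_fixes list_proj_in_span by (metis image_subset_iff rangeI subsetI subset_antisym)

lemma orth_proj_unique:
  assumes P: "orth_proj P" and Q: "orth_proj Q" and r: "range P = range Q"
  shows "P = Q"
proof
  fix x
  have 1: "Q (P x) = P x" and 2: "P (Q x) = Q x" for x
    using P Q r by (metis orth_proj_fixes rangeI)+
  show "P x = Q x"
    by (rule cinner_eqI_left) (metis 1 2 P Q orth_projD(3))
qed

lemma span_eqI_coords:
  assumes es: "orthonormal_list es" and v: "v \<in> cspan (set es)"
    and "\<And>i. i < length es \<Longrightarrow> cinner v (es ! i) = 0"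
  shows "v = 0"
proof -
  have "v = list_proj es v" using list_proj_fixes[OF es v] by simp
  also have "\<dots> = 0" unfolding list_proj_def by (intro sum.neutral) (simp add: assms(3))
  finally show ?thesis .
qed

lemma norm_orth_proj_le:
  assumes P: "orth_proj P"
  shows "norm (P x) \<le> norm x"
proof -
  have "(norm (P x))\<^sup>2 = inner x (P x)"
    by (simp add: power2_norm_eq_inner inner_eq_Re_cinner orth_projD[OF P])
  also have "\<dots> \<le> norm x * norm (P x)" by (rule norm_cauchy_schwarz)
  finally show ?thesis by (cases "P x = 0") (auto simp: power2_eq_square)
qed

lemma orthogonal_projection_iff:
  "orthogonal_projection P \<longleftrightarrow> orth_proj (blinfun_apply P)"
  by (auto simp: orthogonal_projection_def orth_proj_def clinear_def blinfun.add_right)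

lemma orthonormal_list_rev:
  assumes "orthonormal_list es"
  shows "orthonormal_list (rev es)"
  unfolding orthonormal_list_def
proof (intro allI impI)
  fix i l assume "i < length (rev es)" "l < length (rev es)"
  then show "cinner (rev es ! i) (rev es ! l) = (if i = l then 1 else 0)"
    using assms unfolding orthonormal_list_def by (auto simp: rev_nth)
qed

section \<open>Dimension by leading indices\<close>

definition leading :: "'h::complex_inner list \<Rightarrow> 'h \<Rightarrow> nat \<Rightarrow> bool" where
  "leading es v i \<longleftrightarrow> i < length es \<and> cinner v (es ! i) \<noteq> 0 \<and>
    (\<forall>l<length es. i < l \<longrightarrow> cinner v (es ! l) = 0)"

lemma leading_exists:
  assumes "orthonormal_list es" "v \<in> cspan (set es)" "v \<noteq> 0"
  shows "\<exists>i. leading es v i"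
proof -
  let ?I = "{i. i < length es \<and> cinner v (es ! i) \<noteq> 0}"
  have ne: "?I \<noteq> {}" using span_eqI_coords[OF assms(1,2)] assms(3) by blast
  have fin: "finite ?I" by simp
  have "leading es v (Max ?I)"
    unfolding leading_def using Max_in[OF fin ne] Max_ge[OF fin] by (auto simp: not_le[symmetric])
  then show ?thesis by blast
qed

text \<open>Gaussian elimination: vectors of \<open>R\<close> with distinct leading indices, one for each index that
occurs, form a basis of \<open>R\<close>.\<close>

lemma cdim_echelon:
  assumes es: "orthonormal_list es" and R: "csubspace R" "R \<subseteq> cspan (set es)"
    and S: "S \<subseteq> {..<length es}"
    and lead: "\<And>v i. v \<in> R \<Longrightarrow> leading es v i \<Longrightarrow> i \<in> S"
    and ex: "\<And>i. i \<in> S \<Longrightarrow> \<exists>v\<in>R. leading es v i"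
  shows "cdim R = card S"
proof -
  \<comment> \<open>The truncations \<open>Rm m\<close> consist of the vectors with leading index below \<open>m\<close>; a basis is built up in
    \<open>m\<close>, with a new vector whenever \<open>m \<in> S\<close>.\<close>
  define Rm where "Rm = (\<lambda>m. {v \<in> R. \<forall>l<length es. m \<le> l \<longrightarrow> cinner v (es ! l) = 0})"
  have sub: "csubspace (Rm m)" for m
    using R(1) by (auto simp: Rm_def complex_vector.subspace_def cinner_simps)
  have "\<exists>B. complex_vector.independent B \<and> finite B \<and> card B = card (S \<inter> {..<m}) \<and> cspan B = Rm m"
    for m
  proof (induction m)
    case 0
    have "v = 0" if "v \<in> Rm 0" for v
      using that R(2) by (intro span_eqI_coords[OF es]) (auto simp: Rm_def)
    then have "Rm 0 = {0}" using complex_vector.subspace_0[OF sub] by blast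
    then show ?case by (intro exI[of _ "{}"]) (auto simp: complex_vector.independent_empty)
  next
    case (Suc m)
    then obtain B where B: "complex_vector.independent B" "finite B" "card B = card (S \<inter> {..<m})"
      "cspan B = Rm m" by blast
    show ?case
    proof (cases "m \<in> S")
      case True
      then obtain w where w: "w \<in> R" "leading es w m" using ex by blast
      have m: "m < length es" and wm: "cinner w (es ! m) \<noteq> 0" using w by (auto simp: leading_def)
      have wn: "w \<notin> cspan B" using m wm B(4) by (auto simp: Rm_def)
      have "cspan (insert w B) = Rm (Suc m)"
      proof
        have "Rm m \<subseteq> Rm (Suc m)" by (auto simp: Rm_def)
        moreover have "w \<in> Rm (Suc m)" using w by (auto simp: Rm_def leading_def)
        ultimately show "cspan (insert w B) \<subseteq> Rm (Suc m)"
          using B(4) complex_vector.span_superset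
          by (intro complex_vector.span_minimal sub) blast
        show "Rm (Suc m) \<subseteq> cspan (insert w B)"
        proof
          fix x assume x: "x \<in> Rm (Suc m)"
          define c where "c = cinner x (es ! m) / cinner w (es ! m)"
          have "x - c *\<^sub>C w \<in> R"
            using x w R(1)
            by (auto simp: Rm_def intro: complex_vector.subspace_diff complex_vector.subspace_scale)
          moreover have "cinner (x - c *\<^sub>C w) (es ! l) = 0" if "l < length es" "m \<le> l" for l
            using that x w wm by (cases "l = m") (auto simp: Rm_def leading_def c_def cinner_simps)
          ultimately have "x - c *\<^sub>C w \<in> cspan B" using B(4) by (auto simp: Rm_def)
          then show "x \<in> cspan (insert w B)" using complex_vector.span_breakdown_eq by blast
        qed
      qed
      moreover have "S \<inter> {..<Suc m} = insert m (S \<inter> {..<m})" using True by auto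
      moreover have "w \<notin> B" using wn complex_vector.span_base by blast
      moreover have "complex_vector.independent (insert w B)"
        using wn B(1) by (rule complex_vector.independent_insertI)
      ultimately show ?thesis using B
        by (intro exI[of _ "insert w B"]) auto
    next
      case False
      have "cinner v (es ! m) = 0" if "v \<in> Rm (Suc m)" "m < length es" for v
        using that lead[of v m] False by (auto simp: Rm_def leading_def)
      then have "Rm (Suc m) = Rm m"
        by (auto simp: Rm_def) (metis le_antisym not_less_eq_eq)
      moreover have "S \<inter> {..<Suc m} = S \<inter> {..<m}" using False by (auto simp: less_Suc_eq)
      ultimately show ?thesis using B by auto
    qed
  qed
  from this[of "length es"] obtain B where B: "complex_vector.independent B"
    "card B = card (S \<inter> {..<length es})" "cspan B = Rm (length es)" by blast
  have "Rm (length es) = R" by (auto simp: Rm_def)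
  then have "cspan B = cspan R" using B(3) R(1) by (simp add: complex_vector.span_eq_iff[THEN iffD2])
  then have "cdim R = card B" using B(1) by (intro complex_vector.dim_eq_card)
  also have "\<dots> = card S" using B(2) S by (simp add: Int_absorb2)
  finally show ?thesis .
qed

lemma cdim_orthonormal:
  assumes "orthonormal_list es"
  shows "cdim (cspan (set es)) = length es"
proof -
  have "cdim (cspan (set es)) = card {..<length es}"
  proof (rule cdim_echelon[OF assms])
    fix i assume "i \<in> {..<length es}"
    then show "\<exists>v\<in>cspan (set es). leading es v i"
      using assms
      by (intro bexI[of _ "es ! i"])
         (auto simp: leading_def orthonormal_list_def intro: complex_vector.span_base)
  qed (auto simp: leading_def)
  then show ?thesis by simp
qed

section \<open>Common eigenvectors and simultaneous triangularization\<close>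

text \<open>The vector \<open>p(A) w\<close>, evaluated by Horner's scheme.\<close>

definition orbit_poly :: "('h::complex_inner \<Rightarrow> 'h) \<Rightarrow> 'h \<Rightarrow> complex poly \<Rightarrow> 'h" where
  "orbit_poly A w p = fold_coeffs (\<lambda>a x. a *\<^sub>C w + A x) p 0"

lemma orbit_poly_0 [simp]: "orbit_poly A w 0 = 0"
  by (simp add: orbit_poly_def)

lemma orbit_poly_pCons:
  assumes "clinear A"
  shows "orbit_poly A w (pCons a p) = a *\<^sub>C w + A (orbit_poly A w p)"
  by (cases "a = 0 \<and> p = 0") (auto simp: orbit_poly_def clinear_zero[OF assms])

lemma orbit_poly_add:
  assumes "clinear A"
  shows "orbit_poly A w (p + q) = orbit_poly A w p + orbit_poly A w q"
  by (induction p q rule: poly_induct2)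
     (simp_all add: orbit_poly_pCons[OF assms] clinear_add[OF assms] scaleC_add_left)

lemma orbit_poly_smult:
  assumes "clinear A"
  shows "orbit_poly A w (smult c p) = c *\<^sub>C orbit_poly A w p"
  by (induction p)
     (simp_all add: orbit_poly_pCons[OF assms] clinear_scaleC[OF assms] scaleC_add_right scaleC_scaleC)

lemma orbit_poly_monom: "clinear A \<Longrightarrow> orbit_poly A w (monom 1 k) = (A ^^ k) w"
  by (induction k) (simp_all add: monom_0 monom_Suc orbit_poly_pCons scaleC_one clinear_zero)

lemma orbit_poly_mem:
  assumes "clinear A" "csubspace W" "\<And>v. v \<in> W \<Longrightarrow> A v \<in> W" "w \<in> W"
  shows "orbit_poly A w p \<in> W"
  by (induction p)
     (use assms in \<open>auto simp: orbit_poly_pCons complex_vector.subspace_0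
       intro!: complex_vector.subspace_add complex_vector.subspace_scale\<close>)

text \<open>Independent sets are bounded instead of \<^const>\<open>cdim\<close>, which is \<open>0\<close> for infinite-dimensional spaces
and so cannot express a bound.\<close>

definition dim_at_most :: "nat \<Rightarrow> 'h::complex_inner set \<Rightarrow> bool" where
  "dim_at_most n V \<longleftrightarrow> (\<forall>I\<subseteq>V. complex_vector.independent I \<longrightarrow> finite I \<and> card I \<le> n)"

lemma dim_at_mostD:
  "dim_at_most n V \<Longrightarrow> I \<subseteq> V \<Longrightarrow> complex_vector.independent I \<Longrightarrow> finite I \<and> card I \<le> n"
  unfolding dim_at_most_def by simp

lemma dim_at_most_cspan: "finite B \<Longrightarrow> dim_at_most (card B) (cspan B)"
  unfolding dim_at_most_def using complex_vector.independent_span_bound by blast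

lemma dim_at_most_mono: "dim_at_most n V \<Longrightarrow> W \<subseteq> V \<Longrightarrow> dim_at_most n W"
  unfolding dim_at_most_def by blast

text \<open>The iterates \<open>w, A w, A\<^sup>2 w, \<dots>\<close> cannot all be independent; the first that depends on its predecessors
gives a monic polynomial.\<close>

lemma exists_annihilating_poly:
  assumes A: "clinear A" and W: "csubspace W" "\<And>v. v \<in> W \<Longrightarrow> A v \<in> W" "w \<in> W"
    and dim: "dim_at_most n W"
  shows "\<exists>p. p \<noteq> 0 \<and> orbit_poly A w p = 0"
proof -
  let ?w = "\<lambda>i. (A ^^ i) w"
  have mem: "?w i \<in> W" for i by (induction i) (use W in auto)
  have "\<exists>k. ?w k \<in> cspan (?w ` {..<k})"
  proof (rule ccontr)
    assume "\<not> ?thesis"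
    then have new: "?w k \<notin> cspan (?w ` {..<k})" for k by blast
    have "complex_vector.independent (?w ` {..<k}) \<and> card (?w ` {..<k}) = k" for k
    proof (induction k)
      case (Suc k)
      have "?w k \<notin> ?w ` {..<k}" using new[of k] by (meson complex_vector.span_base)
      moreover have "complex_vector.independent (insert (?w k) (?w ` {..<k}))"
        by (rule complex_vector.independent_insertI[OF new conjunct1[OF Suc]])
      ultimately show ?case using Suc by (simp only: lessThan_Suc image_insert) simp
    qed (simp add: complex_vector.independent_empty)
    moreover have "?w ` {..<Suc n} \<subseteq> W" using mem by blast
    ultimately show False using dim unfolding dim_at_most_def by (metis Suc_n_not_le_n)
  qed
  then obtain k where k: "?w k \<in> cspan (?w ` {..<k})" by blast
  have "\<exists>q. ?w k = orbit_poly A w q \<and> (\<forall>i\<ge>k. coeff q i = 0)"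
    using k
  proof (induction rule: complex_vector.span_induct)
    case base
    show ?case
      unfolding complex_vector.subspace_def
    proof (safe, goal_cases)
      case 1 show ?case by (intro exI[of _ 0]) simp
    next
      case (2 _ _ q r) then show ?case
        by (intro exI[of _ "q + r"]) (simp add: orbit_poly_add[OF A])
    next
      case (3 c _ q) then show ?case
        by (intro exI[of _ "smult c q"]) (simp add: orbit_poly_smult[OF A])
    qed
  next
    case (step x)
    then obtain i where "i < k" "x = ?w i" by blast
    then show ?case by (intro exI[of _ "monom 1 i"]) (simp add: orbit_poly_monom[OF A])
  qed
  then obtain q where q: "?w k = orbit_poly A w q" "\<forall>i\<ge>k. coeff q i = 0" by blast
  let ?p = "monom 1 k + smult (-1) q"
  have "coeff ?p k = 1" using q(2) by simp
  then have "?p \<noteq> 0" by (metis coeff_0 zero_neq_one)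
  moreover have "orbit_poly A w ?p = 0"
    by (simp only: orbit_poly_add[OF A] orbit_poly_smult[OF A] orbit_poly_monom[OF A] q(1)
        scaleC_minus_one) simp
  ultimately show ?thesis by blast
qed

text \<open>Dividing an annihilating polynomial of least degree by a linear factor \<open>x - z\<close> gives a polynomial \<open>q\<close>
with \<open>q(A) w \<noteq> 0\<close>, and this vector is an eigenvector for \<open>z\<close>.\<close>

lemma eigenvector_exists:
  assumes A: "clinear A" and W: "csubspace W" "\<And>v. v \<in> W \<Longrightarrow> A v \<in> W" and ne: "W \<noteq> {0}"
    and dim: "dim_at_most n W"
  shows "\<exists>v\<in>W. v \<noteq> 0 \<and> (\<exists>c. A v = c *\<^sub>C v)"
proof -
  obtain w where w: "w \<in> W" "w \<noteq> 0" using ne complex_vector.subspace_0[OF W(1)] by blast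
  let ?P = "\<lambda>p. p \<noteq> 0 \<and> orbit_poly A w p = 0"
  obtain p where p: "?P p" and min: "\<And>q. ?P q \<Longrightarrow> degree p \<le> degree q"
    using exists_annihilating_poly[OF A W w(1) dim] ex_has_least_nat[of ?P _ degree] by metis
  have "degree p \<noteq> 0"
  proof
    assume "degree p = 0"
    then obtain a where "p = [:a:]" by (rule degree_eq_zeroE)
    then show False using p w by (auto simp: orbit_poly_pCons[OF A] clinear_zero[OF A])
  qed
  then obtain z where "poly p z = 0"
    using fundamental_theorem_of_algebra_alt[of p] by fastforce
  then obtain q where q: "p = [:-z, 1:] * q" using poly_eq_0_iff_dvd by (metis dvdE)
  have "q \<noteq> 0" using p q by auto
  then have "degree p = Suc (degree q)" using q by (simp add: degree_mult_eq del: mult_pCons_left)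
  then have "orbit_poly A w q \<noteq> 0" using min[of q] \<open>q \<noteq> 0\<close> by force
  moreover have "A (orbit_poly A w q) = z *\<^sub>C orbit_poly A w q"
  proof -
    have "p = pCons 0 q + smult (-z) q" using q by simp
    then have "0 = A (orbit_poly A w q) + (-z) *\<^sub>C orbit_poly A w q"
      using p by (simp only: orbit_poly_add[OF A] orbit_poly_smult[OF A] orbit_poly_pCons[OF A]) simp
    then show ?thesis by (simp add: complex_vector.scale_minus_left)
  qed
  ultimately show ?thesis using orbit_poly_mem[OF A W w(1)] by blast
qed

text \<open>The operators are added one at a time: the joint eigenspace of those treated so far is
invariant under the next one because they commute.\<close>

lemma common_eigenvector:
  assumes "finite J" and A: "\<And>j. clinear (A j)" and V: "csubspace V" "V \<noteq> {0}"
    and inv: "\<And>j v. v \<in> V \<Longrightarrow> A j v \<in> V"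
    and comm: "\<And>j k v. v \<in> V \<Longrightarrow> A j (A k v) = A k (A j v)"
    and dim: "dim_at_most n V"
  shows "\<exists>v\<in>V. v \<noteq> 0 \<and> (\<exists>c. \<forall>j\<in>J. A j v = c j *\<^sub>C v)"
  using assms(1)
proof (induction J rule: finite_induct)
  case empty
  then show ?case using V complex_vector.subspace_0[OF V(1)] by auto
next
  case (insert k J)
  then obtain u c where u: "u \<in> V" "u \<noteq> 0" "\<forall>j\<in>J. A j u = c j *\<^sub>C u" by blast
  let ?W = "{v \<in> V. \<forall>j\<in>J. A j v = c j *\<^sub>C v}"
  have sub: "csubspace ?W"
    using V(1) by (auto simp: complex_vector.subspace_def clinear_add[OF A] clinear_scaleC[OF A]
        clinear_zero[OF A] scaleC_add_right scaleC_scaleC mult.commute)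
  have inv': "A k v \<in> ?W" if "v \<in> ?W" for v
    using that inv comm[of v _ k] by (auto simp: clinear_scaleC[OF A])
  have ne: "?W \<noteq> {0}" using u by blast
  have "dim_at_most n ?W" using dim by (rule dim_at_most_mono) auto
  then obtain v d where v: "v \<in> ?W" "v \<noteq> 0" "A k v = d *\<^sub>C v"
    using eigenvector_exists[OF A sub inv' ne] by blast
  have "\<forall>j\<in>insert k J. A j v = (c(k := d)) j *\<^sub>C v" using v insert.hyps by auto
  then show ?case using v by blast
qed

text \<open>The matrix entries are taken of \<open>A j\<close> itself, not of its compression to the span of \<open>es\<close>, which has the same
entries. So the condition does not mention the projection onto the span, and it is closed under limits.\<close>

definition triangular ::
  "('d \<Rightarrow> 'h::complex_inner \<Rightarrow> 'h) \<Rightarrow> 'h list \<Rightarrow> (complex^'d) list \<Rightarrow> bool" where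
  "triangular A es \<mu>s \<longleftrightarrow> length \<mu>s = length es \<and> orthonormal_list es \<and>
    (\<forall>j. \<forall>i<length es. cinner (A j (es ! i)) (es ! i) = \<mu>s ! i $ j \<and>
      (\<forall>l<length es. i < l \<longrightarrow> cinner (A j (es ! i)) (es ! l) = 0))"

lemma orthonormal_list_Cons:
  "orthonormal_list (v # es) \<longleftrightarrow>
    cinner v v = 1 \<and> orthonormal_list es \<and> (\<forall>e\<in>set es. cinner v e = 0)"
  (is "?L \<longleftrightarrow> ?R")
proof
  assume L: ?L
  have *: "cinner ((v # es) ! i) ((v # es) ! l) = (if i = l then 1 else 0)"
    if "i \<le> length es" "l \<le> length es" for i l
    using L that by (simp add: orthonormal_list_def)
  show ?R
    using *[of 0 0] *[of 0 "Suc _"] *[of "Suc _" "Suc _"]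
    by (auto simp: orthonormal_list_def in_set_conv_nth Suc_le_eq)
next
  assume R: ?R
  have "cinner (es ! i) v = 0" if "i < length es" for i
    using R that cinner_commute[of "es ! i" v] by auto
  then show ?L
    using R by (auto simp: orthonormal_list_def nth_Cons split: nat.splits)
qed

lemma triangular_Cons:
  assumes "triangular A es \<mu>s" "cinner v v = 1" "\<And>e. e \<in> set es \<Longrightarrow> cinner v e = 0"
    "\<And>j. cinner (A j v) v = \<mu> $ j" "\<And>j e. e \<in> set es \<Longrightarrow> cinner (A j v) e = 0"
  shows "triangular A (v # es) (\<mu> # \<mu>s)"
proof -
  have "orthonormal_list (v # es)" using assms by (simp add: orthonormal_list_Cons triangular_def)
  then show ?thesis using assms
    by (auto simp: triangular_def nth_Cons split: nat.splits)
qed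

lemma unit_multiple:
  assumes "csubspace V" "u \<in> V" "(u::'h::complex_inner) \<noteq> 0"
  shows "complex_of_real (1 / norm u) *\<^sub>C u \<in> V"
    "cinner (complex_of_real (1 / norm u) *\<^sub>C u) (complex_of_real (1 / norm u) *\<^sub>C u) = 1"
  using assms by (auto simp: complex_vector.subspace_scale cinner_self norm_scaleC norm_divide)

text \<open>The hypothesis on \<open>P\<close> says that its range is invariant under the adjoints of the \<open>M j\<close>. If \<open>v\<close> is a
common eigenvector of the compressions, its orthogonal complement in the range is again invariant
under the adjoints, and a basis of it that exists by induction is extended by putting \<open>v\<close> in front.\<close>

lemma schur_triangularization:
  fixes M :: "'d::finite \<Rightarrow> 'h::complex_inner \<Rightarrow> 'h"
  assumes M: "\<And>j. clinear (M j)" and comm: "\<And>j k x. M j (M k x) = M k (M j x)"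
    and P: "orth_proj P" and PM: "\<And>j x. P (M j (P x)) = P (M j x)"
    and dim: "dim_at_most n (range P)"
  shows "\<exists>es \<mu>s. triangular M es \<mu>s \<and> cspan (set es) = range P"
  using P PM dim
proof (induction n arbitrary: P rule: less_induct)
  case (less n P)
  note P = orth_projD[OF less.prems(1)]
  note PM = less.prems(2)
  have sub: "csubspace (range P)" using P(1) by (rule clinear_range_subspace)
  show ?case
  proof (cases "range P = {0}")
    case True
    have "triangular M [] ([] :: (complex^'d) list)"
      by (simp add: triangular_def orthonormal_list_def)
    moreover have "cspan (set []) = range P" using True by simp
    ultimately show ?thesis by blast
  next
    case False
    have cl: "clinear (\<lambda>x. P (M j x))" for j
      using P(1) M by (simp add: clinear_def)
    have "\<exists>u\<in>range P. u \<noteq> 0 \<and> (\<exists>c. \<forall>j\<in>UNIV. P (M j u) = c j *\<^sub>C u)"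
      by (rule common_eigenvector[OF finite cl sub False _ _ less.prems(3)])
         (auto simp: PM comm)
    then obtain u c where u: "u \<in> range P" "u \<noteq> 0" "\<And>j. P (M j u) = c j *\<^sub>C u" by auto
    define v where "v = complex_of_real (1 / norm u) *\<^sub>C u"
    have v: "v \<in> range P" "cinner v v = 1" unfolding v_def using unit_multiple[OF sub u(1,2)] by auto
    have Pv: "P v = v" using v(1) less.prems(1) orth_proj_fixes by blast
    have PMv: "P (M j v) = c j *\<^sub>C v" for j
      by (simp add: v_def clinear_scaleC[OF M] clinear_scaleC[OF P(1)] u(3)
          complex_vector.scale_left_commute)
    \<comment> \<open>The projection onto the orthogonal complement of \<open>v\<close> in the range of \<open>P\<close>.\<close>
    define Q where "Q = (\<lambda>x. P x - cinner x v *\<^sub>C v)"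
    have Qx: "Q x = P x - cinner x v *\<^sub>C v" for x by (simp add: Q_def)
    have Pxv: "cinner (P x) v = cinner x v" for x using P(3) Pv by metis
    have Qv: "cinner (Q x) v = 0" for x by (simp add: Q_def cinner_simps Pxv v(2))
    have PQ: "P (Q x) = Q x" for x
      by (simp add: Q_def clinear_diff[OF P(1)] clinear_scaleC[OF P(1)] P(2) Pv)
    have clQ: "clinear Q"
      by (auto simp: clinear_def Q_def clinear_add[OF P(1)] clinear_scaleC[OF P(1)] cinner_simps
          scaleC_add_left scaleC_scaleC complex_vector.scale_right_diff_distrib)
    have QQ: "Q (Q x) = Q x" for x
      using Qx[of "Q x"] by (simp add: PQ Qv)
    have Qsa: "cinner (Q x) y = cinner x (Q y)" for x y
      by (simp add: Q_def cinner_simps P(3) mult.commute flip: cinner_commute)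
    have Q: "orth_proj Q" using clQ QQ Qsa by (simp add: orth_proj_def)
    have QP: "Q (P x) = Q x" for x by (simp add: Q_def P(2) Pxv)
    have QM: "Q (M j (Q x)) = Q (M j x)" for j x
    proof -
      have "Q (M j (Q x)) = Q (P (M j (P x))) - cinner x v *\<^sub>C Q (P (M j v))"
        unfolding Qx[of x] QP
        by (simp add: clinear_diff[OF M] clinear_scaleC[OF M] clinear_diff[OF clQ] clinear_scaleC[OF clQ])
      also have "Q (P (M j v)) = 0"
        by (simp add: PMv clinear_scaleC[OF clQ]) (simp add: Q_def Pv v(2) scaleC_one)
      finally show ?thesis by (simp add: PM QP)
    qed
    have vnz: "v \<noteq> 0" using v(2) by auto
    have subQ: "range Q \<subseteq> range P" by (metis PQ image_subset_iff rangeI)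
    have newv: "v \<notin> cspan I" if "I \<subseteq> range Q" for I
    proof
      assume "v \<in> cspan I"
      moreover have "cspan I \<subseteq> range Q"
        using that clinear_range_subspace[OF clQ] by (rule complex_vector.span_minimal)
      ultimately show False using Qv v(2) by force
    qed
    have step: "finite I \<and> card I < n" if I: "I \<subseteq> range Q" "complex_vector.independent I" for I
    proof -
      have "complex_vector.independent (insert v I)"
        using newv I by (intro complex_vector.independent_insertI)
      moreover have "insert v I \<subseteq> range P" using I subQ v by blast
      ultimately have "finite (insert v I) \<and> card (insert v I) \<le> n"
        by (intro dim_at_mostD[OF less.prems(3)])
      moreover have "v \<notin> I" using newv[OF I(1)] by (meson complex_vector.span_base)
      ultimately show ?thesis by auto
    qed
    have "0 < n" using step[of "{}"] complex_vector.independent_empty by auto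
    have "n - 1 < n" using \<open>0 < n\<close> by simp
    moreover have "dim_at_most (n - 1) (range Q)"
      unfolding dim_at_most_def
    proof (intro allI impI)
      fix I assume "I \<subseteq> range Q" "complex_vector.independent I"
      from step[OF this] show "finite I \<and> card I \<le> n - 1" by linarith
    qed
    ultimately obtain es \<mu>s where es: "triangular M es \<mu>s" "cspan (set es) = range Q"
      using less.IH[OF _ Q QM] by blast
    have eQ: "e \<in> range Q" if "e \<in> set es" for e
      using es(2) that complex_vector.span_base by blast
    have ev: "cinner v e = 0" if "e \<in> set es" for e
      using eQ[OF that] Qv by (subst cinner_commute) auto
    have "triangular M (v # es) ((\<chi> j. c j) # \<mu>s)"
    proof (rule triangular_Cons[OF es(1) v(2) ev])
      show "cinner (M j v) v = (\<chi> j. c j) $ j" for j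
        using PMv[of j] Pxv[of "M j v"] v(2) by (simp add: cinner_simps)
      show "cinner (M j v) e = 0" if "e \<in> set es" for j e
      proof -
        have "P e = e" using eQ[OF that] subQ less.prems(1) orth_proj_fixes by blast
        then have "cinner (M j v) e = cinner (P (M j v)) e" using P(3) by metis
        then show ?thesis using ev[OF that] by (simp add: PMv cinner_simps)
      qed
    qed
    moreover have "cspan (set (v # es)) = range P"
    proof
      show "cspan (set (v # es)) \<subseteq> range P"
        using v(1) eQ subQ by (intro complex_vector.span_minimal sub) auto
      have "x \<in> cspan (insert v (set es))" if "x \<in> range P" for x
      proof -
        have "x - cinner x v *\<^sub>C v = Q x" using orth_proj_fixes[OF less.prems(1) that] by (simp add: Q_def)
        then show ?thesis using es(2) complex_vector.span_breakdown_eq by (metis rangeI)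
      qed
      then show "range P \<subseteq> cspan (set (v # es))" by auto
    qed
    ultimately show ?thesis by blast
  qed
qed

section \<open>The joint spectrum of a triangular tuple\<close>

text \<open>Words in the operators replace products of powers: they can be split at any letter, which suits
induction, and they need no enumeration of the coordinates.\<close>

primrec op_word :: "('d \<Rightarrow> 'h \<Rightarrow> 'h) \<Rightarrow> 'd list \<Rightarrow> 'h \<Rightarrow> 'h" where
  "op_word B [] v = v"
| "op_word B (j # js) v = B j (op_word B js v)"

lemma op_word_append: "op_word B (js @ ks) v = op_word B js (op_word B ks v)"
  by (induction js) auto

lemma op_word_replicate: "op_word B (replicate k j) v = (B j ^^ k) v"
  by (induction k) auto

lemma multi_power_eq_op_word:
  fixes \<alpha> :: "'d::finite \<Rightarrow> nat"
  obtains js where "length js = (\<Sum>j\<in>UNIV. \<alpha> j)" "\<And>j. j \<in> set js \<Longrightarrow> \<alpha> j \<noteq> 0"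
    "\<And>B :: 'd \<Rightarrow> 'h \<Rightarrow> 'h. multi_power B \<alpha> = op_word B js"
proof
  define ks where "ks = (SOME js::'d list. distinct js \<and> set js = UNIV)"
  have ks: "distinct ks" "set ks = UNIV"
    using someI_ex[of "\<lambda>js::'d list. distinct js \<and> set js = UNIV"]
      finite_distinct_list[of "UNIV :: 'd set"] unfolding ks_def by auto
  let ?js = "concat (map (\<lambda>j. replicate (\<alpha> j) j) ks)"
  have "length ?js = sum_list (map \<alpha> ks)" by (simp add: length_concat o_def)
  then show "length ?js = (\<Sum>j\<in>UNIV. \<alpha> j)" using ks by (simp add: sum_list_distinct_conv_sum_set)
  show "\<And>j. j \<in> set ?js \<Longrightarrow> \<alpha> j \<noteq> 0" by auto
  have "foldr (\<lambda>j T. (B j ^^ \<alpha> j) \<circ> T) xs id v = op_word B (concat (map (\<lambda>j. replicate (\<alpha> j) j) xs)) v"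
    for B :: "'d \<Rightarrow> 'h \<Rightarrow> 'h" and xs v
    by (induction xs) (auto simp: op_word_append op_word_replicate)
  then show "multi_power B \<alpha> = op_word B ?js" for B :: "'d \<Rightarrow> 'h \<Rightarrow> 'h"
    unfolding multi_power_def ks_def[symmetric] by blast
qed

locale triangular_tuple =
  fixes A :: "'d::finite \<Rightarrow> 'h::complex_hilbert \<Rightarrow> 'h" and es :: "'h list" and \<mu>s :: "(complex^'d) list"
  assumes lin: "clinear (A j)"
    and inv: "v \<in> cspan (set es) \<Longrightarrow> A j v \<in> cspan (set es)"
    and comm: "v \<in> cspan (set es) \<Longrightarrow> A j (A k v) = A k (A j v)"
    and tri: "triangular A es \<mu>s"
begin

lemma len: "length \<mu>s = length es" and orthonormal: "orthonormal_list es"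
  and diag: "i < length es \<Longrightarrow> cinner (A j (es ! i)) (es ! i) = \<mu>s ! i $ j"
  and off_diag: "i < l \<Longrightarrow> l < length es \<Longrightarrow> cinner (A j (es ! i)) (es ! l) = 0"
  using tri by (auto simp: triangular_def)

abbreviation V where "V \<equiv> cspan (set es)"

text \<open>The span of the first \<open>m\<close> vectors of the basis, described by coordinates.\<close>

definition below :: "nat \<Rightarrow> 'h set" where
  "below m = {v \<in> V. \<forall>l<length es. m \<le> l \<longrightarrow> cinner v (es ! l) = 0}"

definition shift :: "complex^'d \<Rightarrow> 'd \<Rightarrow> 'h \<Rightarrow> 'h" where
  "shift \<mu> j v = A j v - (\<mu> $ j) *\<^sub>C v"

lemma shift_0 [simp]: "shift \<mu> j 0 = 0"
  by (simp add: shift_def clinear_zero[OF lin])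

lemma shift_in: "v \<in> V \<Longrightarrow> shift \<mu> j v \<in> V"
  unfolding shift_def
  by (intro complex_vector.span_diff complex_vector.span_scale inv)

lemma shift_commute: "v \<in> V \<Longrightarrow> shift \<mu> j (shift \<nu> k v) = shift \<nu> k (shift \<mu> j v)"
  using comm[of v j k]
  by (simp add: shift_def clinear_diff[OF lin] clinear_scaleC[OF lin]
      complex_vector.scale_right_diff_distrib complex_vector.scale_left_commute)

lemma below_Suc_coord:
  assumes v: "v \<in> below (Suc i)" and i: "i < length es"
  shows "cinner (A j v) (es ! i) = \<mu>s ! i $ j * cinner v (es ! i)"
    and "l < length es \<Longrightarrow> i < l \<Longrightarrow> cinner (A j v) (es ! l) = 0"
proof -
  have vV: "v \<in> V" using v by (simp add: below_def)
  have expand: "cinner (A j v) (es ! l) = (\<Sum>k<length es. cinner v (es ! k) * cinner (A j (es ! k)) (es ! l))"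
    for l
  proof -
    have "cinner (A j v) (es ! l) = cinner (A j (list_proj es v)) (es ! l)"
      using list_proj_fixes[OF orthonormal vV] by simp
    then show ?thesis
      by (simp add: list_proj_def clinear_sum[OF lin] clinear_scaleC[OF lin] cinner_simps)
  qed
  have z: "cinner v (es ! k) = 0" if "i < k" "k < length es" for k
    using v that by (auto simp: below_def)
  have "cinner (A j v) (es ! i) = (\<Sum>k<length es. if k = i then cinner v (es ! i) * \<mu>s ! i $ j else 0)"
    unfolding expand
  proof (rule sum.cong)
    fix k assume "k \<in> {..<length es}"
    then show "cinner v (es ! k) * cinner (A j (es ! k)) (es ! i) =
        (if k = i then cinner v (es ! i) * \<mu>s ! i $ j else 0)"
      using z[of k] off_diag[of k i j] diag[of i j] i by (cases k i rule: linorder_cases) auto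
  qed simp
  then show "cinner (A j v) (es ! i) = \<mu>s ! i $ j * cinner v (es ! i)" using i by simp
  show "cinner (A j v) (es ! l) = 0" if "l < length es" "i < l"
    unfolding expand
  proof (rule sum.neutral, rule ballI)
    fix k assume "k \<in> {..<length es}"
    then show "cinner v (es ! k) * cinner (A j (es ! k)) (es ! l) = 0"
      using z[of k] off_diag[of k l j] that by (cases "i < k") auto
  qed
qed

lemma shift_below_Suc:
  assumes v: "v \<in> below (Suc i)" and i: "i < length es"
  shows "shift \<mu> j v \<in> below (Suc i)"
    and "cinner (shift \<mu> j v) (es ! i) = (\<mu>s ! i $ j - \<mu> $ j) * cinner v (es ! i)"
  using below_Suc_coord[OF assms] v shift_in[of v \<mu> j]
  by (auto simp: below_def shift_def cinner_simps algebra_simps Suc_le_eq)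

lemma shift_lowers:
  assumes v: "v \<in> below (Suc i)" and i: "i < length es" and eq: "\<mu>s ! i $ j = \<mu> $ j"
  shows "shift \<mu> j v \<in> below i"
proof -
  have "cinner (shift \<mu> j v) (es ! l) = 0" if "l < length es" "i \<le> l" for l
    using shift_below_Suc[OF v i, of \<mu> j] that eq by (cases "l = i") (auto simp: below_def)
  then show ?thesis using shift_below_Suc(1)[OF v i, of \<mu> j] by (auto simp: below_def)
qed

lemma leading_iff_below:
  "v \<in> V \<Longrightarrow> leading es v i \<longleftrightarrow> i < length es \<and> v \<in> below (Suc i) \<and> cinner v (es ! i) \<noteq> 0"
  by (auto simp: leading_def below_def Suc_le_eq)

lemma op_word_coord:
  assumes "v \<in> below (Suc i)" "i < length es"
  shows "op_word (shift \<mu>) js v \<in> below (Suc i) \<and>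
    cinner (op_word (shift \<mu>) js v) (es ! i) = (\<Prod>j\<leftarrow>js. \<mu>s ! i $ j - \<mu> $ j) * cinner v (es ! i)"
  by (induction js) (use assms shift_below_Suc in auto)

text \<open>Each factor of the product removes one diagonal entry different from \<open>\<mu>\<close>, so that on the image only
the generalized eigenvectors for \<open>\<mu>\<close> are left. The factors are chosen in the order of the diagonal, which makes
induction along \<^const>\<open>below\<close> possible without reordering them.\<close>

primrec sieve :: "complex^'d \<Rightarrow> nat \<Rightarrow> 'h \<Rightarrow> 'h" where
  "sieve \<mu> 0 v = v"
| "sieve \<mu> (Suc m) v =
    (if \<mu>s ! m = \<mu> then sieve \<mu> m v
     else sieve \<mu> m (shift (\<mu>s ! m) (SOME j. \<mu>s ! m $ j \<noteq> \<mu> $ j) v))"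

lemma some_coord: "\<mu>s ! m \<noteq> \<mu> \<Longrightarrow> \<mu>s ! m $ (SOME j. \<mu>s ! m $ j \<noteq> \<mu> $ j) \<noteq> \<mu> $ (SOME j. \<mu>s ! m $ j \<noteq> \<mu> $ j)"
  using someI_ex[of "\<lambda>j. \<mu>s ! m $ j \<noteq> \<mu> $ j"] by (auto simp: vec_eq_iff)

lemma sieve_0 [simp]: "sieve \<mu> m 0 = 0"
  by (induction m) auto

lemma sieve_shift: "v \<in> V \<Longrightarrow> shift \<mu> j (sieve \<nu> m v) = sieve \<nu> m (shift \<mu> j v)"
  by (induction m arbitrary: v) (auto simp: shift_in shift_commute[of _ \<mu> j])

lemma op_word_0 [simp]: "op_word (shift \<mu>) js 0 = 0"
  by (induction js) auto

text \<open>A simultaneous Cayley-Hamilton theorem. Going down from \<open>m\<close>, the diagonal entry at each index is killed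
either by a factor of the sieve or, if it equals \<open>\<mu>\<close>, by one letter of the word; a word with at
least \<open>m\<close> letters has enough of them.\<close>

lemma op_word_sieve:
  assumes "v \<in> below m" "m \<le> length js" "m \<le> length es"
  shows "op_word (shift \<mu>) js (sieve \<mu> m v) = 0"
  using assms
proof (induction m arbitrary: v js)
  case 0
  then have "v = 0" by (intro span_eqI_coords[OF orthonormal]) (auto simp: below_def)
  then show ?case by simp
next
  case (Suc m)
  have vV: "v \<in> V" using Suc.prems(1) by (simp add: below_def)
  have m: "m < length es" using Suc.prems(3) by simp
  show ?case
  proof (cases "\<mu>s ! m = \<mu>")
    case True
    obtain ks j where js: "js = ks @ [j]"
      using Suc.prems(2) by (cases js rule: rev_cases) auto
    have "op_word (shift \<mu>) js (sieve \<mu> (Suc m) v) = op_word (shift \<mu>) ks (sieve \<mu> m (shift \<mu> j v))"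
      using True by (simp add: js op_word_append sieve_shift[OF vV])
    also have "\<dots> = 0"
      using Suc.prems js True m by (intro Suc.IH shift_lowers) auto
    finally show ?thesis .
  next
    case False
    then show ?thesis
      using Suc.prems m by (auto intro!: Suc.IH shift_lowers)
  qed
qed

text \<open>The factors of the sieve multiply the coordinate at \<open>i\<close> by numbers \<open>\<mu> $ j - \<mu>s ! m $ j\<close>, and \<open>j\<close> is
chosen so that these are not zero.\<close>

lemma leading_sieve:
  assumes "v \<in> V" "leading es v i" "\<mu>s ! i = \<mu>"
  shows "sieve \<mu> m v \<in> V \<and> leading es (sieve \<mu> m v) i"
  using assms(1,2)
proof (induction m arbitrary: v)
  case (Suc m)
  show ?case
  proof (cases "\<mu>s ! m = \<mu>")
    case False
    let ?j = "SOME j. \<mu>s ! m $ j \<noteq> \<mu> $ j"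
    have "leading es (shift (\<mu>s ! m) ?j v) i"
      using Suc.prems some_coord[OF False] shift_below_Suc[of v i "\<mu>s ! m" ?j] assms(3)
      by (auto simp: leading_iff_below shift_in)
    then show ?thesis using Suc False by (simp add: shift_in)
  qed (use Suc in simp)
qed simp

lemma sieved_vector:
  assumes "i < length es" "length js = length es"
  shows "sieve (\<mu>s ! i) (length es) (es ! i) \<in> V"
    "leading es (sieve (\<mu>s ! i) (length es) (es ! i)) i"
    "op_word (shift (\<mu>s ! i)) js (sieve (\<mu>s ! i) (length es) (es ! i)) = 0"
proof -
  have "es ! i \<in> V" "leading es (es ! i) i"
    using assms orthonormal
    by (auto simp: leading_def orthonormal_list_def intro: complex_vector.span_base)
  then show "sieve (\<mu>s ! i) (length es) (es ! i) \<in> V"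
    "leading es (sieve (\<mu>s ! i) (length es) (es ! i)) i"
    "op_word (shift (\<mu>s ! i)) js (sieve (\<mu>s ! i) (length es) (es ! i)) = 0"
    using leading_sieve assms(2) by (auto intro!: op_word_sieve simp: below_def)
qed

lemma root_space_eq:
  "root_space V A \<mu> = {v \<in> V. \<forall>\<alpha>. (\<Sum>j\<in>UNIV. \<alpha> j) = length es \<longrightarrow> multi_power (shift \<mu>) \<alpha> v = 0}"
  unfolding root_space_def shift_def cdim_orthonormal[OF orthonormal] ..

text \<open>The leading indices of vectors in the root space are exactly the positions of \<open>\<mu>\<close> on the
diagonal. A leading index is such a position because pure powers of each \<open>A j - \<mu> $ j\<close> act on the leading coordinate
by a power of the difference of the eigenvalues; conversely, sieved basis vectors attain all positions.\<close>

lemma cdim_root_space: "cdim (root_space V A \<mu>) = count (mset \<mu>s) \<mu>"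
proof -
  have cl: "clinear (op_word (shift \<mu>) js)" for js
    by (induction js) (auto simp: clinear_def shift_def clinear_add[OF lin] clinear_scaleC[OF lin]
        scaleC_add_right complex_vector.scale_right_diff_distrib complex_vector.scale_left_commute)
  have "cdim (root_space V A \<mu>) = card {i. i < length es \<and> \<mu>s ! i = \<mu>}"
  proof (rule cdim_echelon[OF orthonormal])
    have "clinear (multi_power (shift \<mu>) \<alpha>)" for \<alpha>
      by (metis multi_power_eq_op_word cl)
    then show "csubspace (root_space V A \<mu>)"
      unfolding root_space_eq complex_vector.subspace_def
      by (auto simp: clinear_add clinear_scaleC clinear_zero complex_vector.span_zero
          intro: complex_vector.span_add complex_vector.span_scale)
    show "root_space V A \<mu> \<subseteq> V" by (auto simp: root_space_def)
    show "{i. i < length es \<and> \<mu>s ! i = \<mu>} \<subseteq> {..<length es}" by auto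
    show "i \<in> {i. i < length es \<and> \<mu>s ! i = \<mu>}" if v: "v \<in> root_space V A \<mu>" "leading es v i" for v i
    proof -
      have i: "i < length es" using v(2) by (simp add: leading_def)
      have vb: "v \<in> below (Suc i)" "cinner v (es ! i) \<noteq> 0"
        using v leading_iff_below[of v i] by (auto simp: root_space_def)
      have "\<mu>s ! i $ j = \<mu> $ j" for j
      proof -
        let ?\<alpha> = "\<lambda>k. if k = j then length es else 0"
        obtain js where js: "\<And>k. k \<in> set js \<Longrightarrow> ?\<alpha> k \<noteq> 0"
          "\<And>B :: 'd \<Rightarrow> 'h \<Rightarrow> 'h. multi_power B ?\<alpha> = op_word B js"
          using multi_power_eq_op_word[of ?\<alpha>] by metis
        have "(\<Sum>k\<in>UNIV. ?\<alpha> k) = length es" by simp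
        then have "multi_power (shift \<mu>) ?\<alpha> v = 0"
          using v(1) unfolding root_space_eq by blast
        then have "op_word (shift \<mu>) js v = 0" by (simp only: js(2))
        then have "(\<Prod>k\<leftarrow>js. \<mu>s ! i $ k - \<mu> $ k) = 0"
          using op_word_coord[OF vb(1) i, of \<mu> js] vb(2) by simp
        then obtain k where "k \<in> set js" "\<mu>s ! i $ k = \<mu> $ k"
          by (auto simp: prod_list_zero_iff)
        moreover have "k = j" using js(1)[OF \<open>k \<in> set js\<close>] by (simp split: if_splits)
        ultimately show ?thesis by simp
      qed
      then show ?thesis using i by (simp add: vec_eq_iff)
    qed
    show "\<exists>v\<in>root_space V A \<mu>. leading es v i" if i: "i \<in> {i. i < length es \<and> \<mu>s ! i = \<mu>}" for i
    proof
      let ?w = "sieve \<mu> (length es) (es ! i)"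
      show "leading es ?w i" using i sieved_vector(2)[of i "replicate (length es) undefined"] by auto
      have "multi_power (shift \<mu>) \<alpha> ?w = 0" if "(\<Sum>j\<in>UNIV. \<alpha> j) = length es" for \<alpha>
      proof -
        obtain js where "length js = (\<Sum>j\<in>UNIV. \<alpha> j)"
          "\<And>B :: 'd \<Rightarrow> 'h \<Rightarrow> 'h. multi_power B \<alpha> = op_word B js"
          using multi_power_eq_op_word[of \<alpha>] by metis
        then show ?thesis using sieved_vector(3)[of i js] i that by auto
      qed
      then show "?w \<in> root_space V A \<mu>"
        using i sieved_vector(1)[of i "replicate (length es) undefined"]
        unfolding root_space_eq by auto
    qed
  qed
  also have "\<dots> = count (mset \<mu>s) \<mu>"
    by (simp add: count_mset count_list_eq_length_filter length_filter_conv_card len conj_commute eq_commute)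
  finally show ?thesis .
qed

text \<open>As long as some \<open>shift \<mu> j\<close> does not kill the vector, apply it; the words that annihilate the
result are shorter by one letter.\<close>

lemma joint_eigenvector:
  assumes "v \<in> V" "v \<noteq> 0" "\<And>js. length js = m \<Longrightarrow> op_word (shift \<mu>) js v = 0"
  shows "\<exists>u\<in>V. u \<noteq> 0 \<and> (\<forall>j. shift \<mu> j u = 0)"
  using assms
proof (induction m arbitrary: v)
  case (Suc m)
  show ?case
  proof (cases "\<forall>j. shift \<mu> j v = 0")
    case False
    then obtain j where "shift \<mu> j v \<noteq> 0" by blast
    moreover have "op_word (shift \<mu>) js (shift \<mu> j v) = 0" if "length js = m" for js
      using Suc.prems(3)[of "js @ [j]"] that by (simp add: op_word_append)
    ultimately show ?thesis using Suc.IH Suc.prems(1) shift_in by blast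
  qed (use Suc.prems in blast)
qed auto

lemma joint_spectrum_iff:
  "\<mu> \<in> joint_spectrum V A \<longleftrightarrow> (\<exists>v\<in>V. v \<noteq> 0 \<and> (\<forall>j. shift \<mu> j v = 0))"
proof -
  have "0 \<in> {v \<in> V. \<forall>j. shift \<mu> j v = 0}" by (simp add: complex_vector.span_zero)
  then show ?thesis unfolding joint_spectrum_def shift_def[symmetric] by blast
qed

lemma joint_spectrum_eq: "joint_spectrum V A = set \<mu>s"
proof (intro equalityI subsetI)
  fix \<mu> assume "\<mu> \<in> joint_spectrum V A"
  then obtain v where v: "v \<in> V" "v \<noteq> 0" "\<And>j. shift \<mu> j v = 0" by (auto simp: joint_spectrum_iff)
  obtain i where "leading es v i" using leading_exists[OF orthonormal v(1,2)] by blast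
  then have i: "i < length es" "v \<in> below (Suc i)" "cinner v (es ! i) \<noteq> 0"
    using leading_iff_below[OF v(1)] by auto
  have "\<mu>s ! i $ j = \<mu> $ j" for j
    using shift_below_Suc(2)[OF i(2,1), of \<mu> j] v(3) i(3) by simp
  then have "\<mu> = \<mu>s ! i" by (simp add: vec_eq_iff)
  then show "\<mu> \<in> set \<mu>s" using i(1) len by simp
next
  fix \<mu> assume "\<mu> \<in> set \<mu>s"
  then obtain i where i: "i < length es" "\<mu> = \<mu>s ! i" using len by (auto simp: in_set_conv_nth)
  let ?w = "sieve \<mu> (length es) (es ! i)"
  have "?w \<in> V" "?w \<noteq> 0"
    using i sieved_vector(1,2)[of i "replicate (length es) undefined"] by (auto simp: leading_def)
  then show "\<mu> \<in> joint_spectrum V A"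
    unfolding joint_spectrum_iff using i sieved_vector(3) by (intro joint_eigenvector) auto
qed

lemma joint_spectrum_mset_eq: "joint_spectrum_mset V A = mset \<mu>s"
proof (rule multiset_eqI)
  fix \<nu>
  have "count (joint_spectrum_mset V A) \<nu> =
      (\<Sum>\<mu>\<in>set \<mu>s. if \<mu> = \<nu> then count (mset \<mu>s) \<nu> else 0)"
    unfolding joint_spectrum_mset_def joint_spectrum_eq cdim_root_space
    by (auto simp: count_sum intro!: sum.cong)
  also have "\<dots> = count (mset \<mu>s) \<nu>" by (simp add: count_mset_0_iff)
  finally show "count (joint_spectrum_mset V A) \<nu> = count (mset \<mu>s) \<nu>" .
qed

end

section \<open>Kernels and multipliers of the Drury-Arveson space\<close>

lemma cmod_cdot_le: "cmod (cdot z w) \<le> norm z * norm w"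
proof -
  have "cmod (cdot z w) \<le> (\<Sum>j\<in>UNIV. \<bar>cmod (z $ j)\<bar> * \<bar>cmod (w $ j)\<bar>)"
    unfolding cdot_def by (rule order_trans[OF norm_sum]) (simp add: norm_mult)
  also have "\<dots> \<le> L2_set (\<lambda>j. cmod (z $ j)) UNIV * L2_set (\<lambda>j. cmod (w $ j)) UNIV"
    by (rule L2_set_mult_ineq)
  finally show ?thesis by (simp add: norm_vec_def)
qed

lemma cdot_self: "cdot z z = complex_of_real ((norm z)\<^sup>2)"
proof -
  have "cdot z z = (\<Sum>j\<in>UNIV. complex_of_real ((cmod (z $ j))\<^sup>2))"
    unfolding cdot_def by (intro sum.cong refl complex_norm_square[symmetric])
  then show ?thesis by (simp add: norm_vec_def L2_set_def sum_nonneg)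
qed

lemma cdot_scaleR_right: "cdot z (r *\<^sub>R w) = of_real r * cdot z w"
  by (simp add: cdot_def sum_distrib_left scaleR_conv_of_real[symmetric] complex_cnj_scaleR
      mult_scaleR_right scaleR_sum_right)

lemma one_minus_cdot_ne_0:
  assumes "z \<in> ball 0 1" "w \<in> ball 0 1"
  shows "1 - cdot z w \<noteq> 0"
proof -
  have "cmod (cdot z w) < 1"
    using cmod_cdot_le[of z w] assms mult_strict_mono'[of "norm z" 1 "norm w" 1] by auto
  then show ?thesis by auto
qed

locale drury_arveson_space =
  fixes ev :: "'h::complex_hilbert \<Rightarrow> complex^'d \<Rightarrow> complex"
  assumes da: "drury_arveson ev"
begin

definition kern :: "complex^'d \<Rightarrow> 'h" where
  "kern w = (SOME k. (\<forall>z\<in>ball 0 1. ev k z = 1 / (1 - cdot z w)) \<and> (\<forall>f. ev f w = cinner f k))"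

lemma ev_kern: "z \<in> ball 0 1 \<Longrightarrow> w \<in> ball 0 1 \<Longrightarrow> ev (kern w) z = 1 / (1 - cdot z w)"
  and ev_eq_cinner: "w \<in> ball 0 1 \<Longrightarrow> ev f w = cinner f (kern w)"
proof -
  have *: "(\<forall>z\<in>ball 0 1. ev (kern w) z = 1 / (1 - cdot z w)) \<and> (\<forall>f. ev f w = cinner f (kern w))"
    if "w \<in> ball 0 1" for w
    unfolding kern_def by (rule someI_ex) (use da that in \<open>auto simp: drury_arveson_def rkhs_def\<close>)
  show "z \<in> ball 0 1 \<Longrightarrow> w \<in> ball 0 1 \<Longrightarrow> ev (kern w) z = 1 / (1 - cdot z w)"
    "w \<in> ball 0 1 \<Longrightarrow> ev f w = cinner f (kern w)"
    using * by blast+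
qed

lemma ev_eqI: "(\<And>z. z \<in> ball 0 1 \<Longrightarrow> ev f z = ev g z) \<Longrightarrow> f = g"
  using da by (auto simp: drury_arveson_def rkhs_def)

lemma cinner_kern: "z \<in> ball 0 1 \<Longrightarrow> w \<in> ball 0 1 \<Longrightarrow> cinner (kern w) (kern z) = 1 / (1 - cdot z w)"
  using ev_kern ev_eq_cinner by metis

lemma continuous_ev: "z \<in> ball 0 1 \<Longrightarrow> isCont (ev f) z"
  using da unfolding drury_arveson_def holomorphic_several_def
  by (metis has_derivative_continuous)

lemma ev_mult_op:
  assumes "multiplier ev f" "z \<in> ball 0 1"
  shows "ev (mult_op ev f h) z = f z * ev h z"
proof -
  obtain g where g: "\<forall>z\<in>ball 0 1. ev g z = f z * ev h z"
    using assms(1) by (auto simp: multiplier_def)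
  have "\<forall>z\<in>ball 0 1. ev (mult_op ev f h) z = f z * ev h z"
    unfolding mult_op_def
  proof (rule theI[of _ g])
    show "g' = g" if "\<forall>z\<in>ball 0 1. ev g' z = f z * ev h z" for g'
      using that g by (intro ev_eqI) simp
  qed (rule g)
  then show ?thesis using assms(2) by blast
qed

lemma clinear_mult_op:
  assumes f: "multiplier ev f"
  shows "clinear (mult_op ev f)"
  unfolding clinear_def
proof (intro conjI allI)
  fix x y c
  have *: "cinner (mult_op ev f x) (kern z) = f z * cinner x (kern z)" if "z \<in> ball 0 1" for x z
    using ev_mult_op[OF f that] that by (simp add: ev_eq_cinner)
  show "mult_op ev f (x + y) = mult_op ev f x + mult_op ev f y"
    by (rule ev_eqI) (simp add: ev_eq_cinner * cinner_simps distrib_left)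
  show "mult_op ev f (c *\<^sub>C x) = c *\<^sub>C mult_op ev f x"
    by (rule ev_eqI) (simp add: ev_eq_cinner * cinner_simps)
qed

lemma mult_op_commute:
  assumes "multiplier ev f" "multiplier ev g"
  shows "mult_op ev f (mult_op ev g x) = mult_op ev g (mult_op ev f x)"
  by (rule ev_eqI) (simp add: ev_mult_op assms)

text \<open>Multiplication by \<open>z $ j\<close> is the adjoint of the map \<open>k\<^sub>w \<mapsto> cnj (w $ j) k\<^sub>w\<close>, so it is enough that this
map is well defined and contractive on linear combinations of kernel functions. Both follow from
\<open>\<parallel>\<Sum> c\<^sub>w k\<^sub>w\<parallel>\<^sup>2 = \<bar>\<Sum> c\<^sub>w\<bar>\<^sup>2 + \<Sum>\<^sub>i \<parallel>\<Sum> c\<^sub>w cnj (w $ i) k\<^sub>w\<parallel>\<^sup>2\<close>, which is \<open>(1 - \<langle>z, w\<rangle>) k(z, w) = 1\<close> summed up.\<close>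

lemma multiplier_coord: "multiplier ev (\<lambda>z. z $ j)"
  unfolding multiplier_def
proof
  fix h
  \<comment> \<open>An element \<open>(x, y, s)\<close> of the span of \<open>G\<close> records a combination \<open>x\<close> of kernel functions, its images
    \<open>y $ i\<close> under the maps above, and the sum \<open>s\<close> of its coefficients; \<open>Q\<close> is the polarized identity.\<close>
  define G where "G = {(c *\<^sub>C kern w, (\<chi> i. (c * cnj (w $ i)) *\<^sub>C kern w), c) |c w. w \<in> ball 0 1}"
  define Q where "Q = (\<lambda>p q :: 'h \<times> ('h ^ 'd) \<times> complex. inner (fst p) (fst q) =
    inner (fst (snd p)) (fst (snd q)) + inner (snd (snd p)) (snd (snd q)))"
  have base: "Q p q" if pG: "p \<in> G" and qG: "q \<in> G" for p q
  proof -
    obtain c w where w: "w \<in> ball 0 1" and p: "p = (c *\<^sub>C kern w, (\<chi> i. (c * cnj (w $ i)) *\<^sub>C kern w), c)"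
      using pG by (auto simp: G_def)
    obtain d z where z: "z \<in> ball 0 1" and q: "q = (d *\<^sub>C kern z, (\<chi> i. (d * cnj (z $ i)) *\<^sub>C kern z), d)"
      using qG by (auto simp: G_def)
    have ne: "1 - cdot z w \<noteq> 0" using one_minus_cdot_ne_0[OF z w] .
    have "(\<Sum>i\<in>UNIV. cinner ((c * cnj (w $ i)) *\<^sub>C kern w) ((d * cnj (z $ i)) *\<^sub>C kern z))
        = (\<Sum>i\<in>UNIV. (z $ i * cnj (w $ i)) * (c * cnj d / (1 - cdot z w)))"
      by (intro sum.cong) (simp_all add: cinner_simps cinner_kern[OF z w])
    also have "\<dots> = (\<Sum>i\<in>UNIV. z $ i * cnj (w $ i)) * (c * cnj d / (1 - cdot z w))"
      by (simp only: sum_distrib_right)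
    also have "\<dots> = cdot z w * (c * cnj d / (1 - cdot z w))" by (simp only: cdot_def)
    finally have "(\<Sum>i\<in>UNIV. cinner ((c * cnj (w $ i)) *\<^sub>C kern w) ((d * cnj (z $ i)) *\<^sub>C kern z))
        + c * cnj d = cinner (c *\<^sub>C kern w) (d *\<^sub>C kern z)"
      using ne by (simp add: cinner_simps cinner_kern[OF z w] field_simps)
    then have "Re (cinner (c *\<^sub>C kern w) (d *\<^sub>C kern z)) =
      (\<Sum>i\<in>UNIV. Re (cinner ((c * cnj (w $ i)) *\<^sub>C kern w) ((d * cnj (z $ i)) *\<^sub>C kern z))) + Re (c * cnj d)"
      by (metis Re_sum plus_complex.sel(1))
    then show ?thesis
      by (simp add: Q_def p q inner_vec_def inner_eq_Re_cinner inner_complex_def)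
  qed
  have subQ: "subspace {q. Q p q}" for p
    by (auto simp: subspace_def Q_def inner_simps algebra_simps)
  have subQ': "subspace {p. Q p q}" for q
    by (auto simp: subspace_def Q_def inner_simps algebra_simps)
  have 1: "Q p q" if "p \<in> G" "q \<in> span G" for p q
    using that(2) subQ by (rule span_induct) (use base that in auto)
  have Q: "Q p q" if "p \<in> span G" "q \<in> span G" for p q
    using that(1) subQ' by (rule span_induct) (use 1 that in auto)
  define S where "S = (\<lambda>p. (fst p, inner (fst (snd p) $ j) h)) ` span G"
  have "linear (\<lambda>p :: 'h \<times> ('h ^ 'd) \<times> complex. (fst p, inner (fst (snd p) $ j) h))"
    by (rule linearI) (auto simp: inner_simps)
  then have S: "subspace S" unfolding S_def by (intro linear_subspace_image subspace_span)
  have bd: "\<bar>t\<bar> \<le> norm h * norm x" if xt: "(x, t) \<in> S" for x t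
  proof -
    obtain p where p: "p \<in> span G" "x = fst p" "t = inner (fst (snd p) $ j) h"
      using xt by (auto simp: S_def)
    have "(norm (fst (snd p)))\<^sup>2 \<le> (norm x)\<^sup>2"
      using Q[OF p(1) p(1)] by (simp add: Q_def p power2_norm_eq_inner)
    then have "norm (fst (snd p)) \<le> norm x" by (rule power2_le_imp_le) simp
    then have "norm (fst (snd p) $ j) \<le> norm x" by (rule order_trans[OF Finite_Cartesian_Product.norm_nth_le])
    then have "norm (fst (snd p) $ j) * norm h \<le> norm x * norm h" by (rule mult_right_mono) simp
    then show ?thesis
      using Cauchy_Schwarz_ineq2[of "fst (snd p) $ j" h] by (simp add: p mult.commute)
  qed
  obtain g where g: "\<And>x t. (x, t) \<in> S \<Longrightarrow> t = inner x g"
    using riesz_graph[OF S norm_ge_zero bd] by blast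
  have "ev g w = w $ j * ev h w" if w: "w \<in> ball 0 1" for w
  proof -
    have r: "Re (cinner ((c * cnj (w $ j)) *\<^sub>C kern w) h) = Re (cinner (c *\<^sub>C kern w) g)" for c
    proof -
      have "(c *\<^sub>C kern w, (\<chi> i. (c * cnj (w $ i)) *\<^sub>C kern w), c) \<in> span G"
        unfolding G_def using w by (intro span_base) blast
      then have "(c *\<^sub>C kern w, inner ((c * cnj (w $ j)) *\<^sub>C kern w) h) \<in> S"
        unfolding S_def by (rule rev_image_eqI) simp
      from g[OF this] show ?thesis by (simp add: inner_eq_Re_cinner)
    qed
    have "cinner (cnj (w $ j) *\<^sub>C kern w) h = cinner (kern w) g"
      using r[of 1] r[of \<i>] by (simp add: cinner_simps scaleC_one complex_eq_iff mult.assoc)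
    then have "cnj (cinner (kern w) g) = w $ j * cnj (cinner (kern w) h)"
      by (metis cinner_scaleC_left complex_cnj_cnj complex_cnj_mult)
    then show ?thesis using w by (simp add: ev_eq_cinner flip: cinner_commute)
  qed
  then show "\<exists>g. \<forall>z\<in>ball 0 1. ev g z = z $ j * ev h z" by blast
qed

text \<open>For \<open>u\<close> in the span of the kernel functions, \<open>x \<mapsto> cinner (f x) u\<close> is represented by a vector, because
\<open>cinner (f x) (kern w) = f w * cinner x (kern w)\<close>. For \<open>\<parallel>u\<parallel> \<le> 1\<close> these functionals are pointwise
bounded by \<open>\<parallel>f x\<parallel>\<close>, hence uniformly bounded. As a vector is determined by its inner products with the
kernel functions, such \<open>u\<close> detect the norm of \<open>f x\<close>.\<close>

lemma multiplier_bounded: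
  assumes f: "multiplier ev f"
  shows "\<exists>C\<ge>0. \<forall>x. norm (mult_op ev f x) \<le> C * norm x"
proof -
  let ?M = "mult_op ev f"
  define D where "D = cspan (kern ` ball 0 1)"
  define G where "G = {g. \<exists>u. norm u \<le> 1 \<and> (\<forall>x. cinner (?M x) u = cinner x g)}"
  have "\<exists>g. \<forall>x. cinner (?M x) u = cinner x g" if "u \<in> D" for u
    using that unfolding D_def
  proof (induction rule: complex_vector.span_induct)
    case base
    show ?case unfolding complex_vector.subspace_def
      by (auto simp: cinner_simps) (metis cinner_zero_right, metis cinner_add_right, metis cinner_scaleC_right)
  next
    case (step u)
    then obtain w where w: "w \<in> ball 0 1" "u = kern w" by blast
    have "cinner (?M x) u = cinner x (cnj (f w) *\<^sub>C kern w)" for x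
      using ev_mult_op[OF f w(1), of x] w by (simp add: ev_eq_cinner cinner_simps)
    then show ?case by blast
  qed
  then have ex: "\<exists>g. \<forall>x. cinner (?M x) u = cinner x g" if "u \<in> D" for u using that .
  have "\<exists>C. \<forall>g\<in>G. cmod (cinner x g) \<le> C" for x
  proof (intro exI ballI)
    fix g assume "g \<in> G"
    then obtain u where "norm u \<le> 1" "cinner (?M x) u = cinner x g" by (auto simp: G_def)
    then show "cmod (cinner x g) \<le> norm (?M x)"
      using norm_cinner_le[of "?M x" u] mult_left_mono[of "norm u" 1 "norm (?M x)"] by simp
  qed
  then obtain C where C: "C \<ge> 0" "\<And>g. g \<in> G \<Longrightarrow> norm g \<le> C"
    using weakly_bounded_imp_bounded by meson
  have bd: "cmod (cinner (?M x) u) \<le> C * norm x * norm u" if u: "u \<in> D" for x u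
  proof (cases "u = 0")
    case False
    define u' where "u' = complex_of_real (1 / norm u) *\<^sub>C u"
    have "u' \<in> D" using u unfolding D_def u'_def by (rule complex_vector.span_scale)
    then obtain g where g: "\<And>x. cinner (?M x) u' = cinner x g" using ex by blast
    have "norm u' = 1" using False by (simp add: u'_def norm_scaleC norm_divide)
    then have "g \<in> G" using g unfolding G_def by (intro CollectI exI[of _ u']) simp
    then have "cmod (cinner (?M x) u') \<le> norm x * C"
      using norm_cinner_le[of x g] C(2)[of g] mult_left_mono[of "norm g" C "norm x"] by (simp add: g)
    moreover have "cmod (cinner (?M x) u') = cmod (cinner (?M x) u) / norm u"
      by (simp add: u'_def cinner_simps norm_mult norm_divide)
    ultimately show ?thesis using False by (simp add: field_simps)
  qed simp
  have "norm (?M x) \<le> C * norm x" for x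
  proof -
    have "cmod (cinner u (?M x)) \<le> C * norm x * norm u" if "u \<in> D" for u
      using bd[OF that, of x] by (subst cinner_commute) simp
    then obtain g where g: "norm g \<le> C * norm x" "\<And>u. u \<in> D \<Longrightarrow> cinner u (?M x) = cinner u g"
      using riesz_csubspace[of D "C * norm x" "\<lambda>u. cinner u (?M x)"] C(1)
      by (auto simp: D_def cinner_simps)
    have "?M x = g"
    proof (rule ev_eqI)
      fix z :: "complex^'d" assume z: "z \<in> ball 0 1"
      then have "kern z \<in> D" unfolding D_def by (intro complex_vector.span_base) simp
      then show "ev (?M x) z = ev g z"
        using g(2) z by (simp add: ev_eq_cinner) (metis cinner_commute)
    qed
    then show ?thesis using g(1) by simp
  qed
  then show ?thesis using C(1) by blast
qed

text \<open>A definite description has the property only if an adjoint exists; boundedness and the Riesz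
representation of \<open>x \<mapsto> cinner (f x) y\<close> provide one.\<close>

lemma cinner_cadjoint:
  assumes f: "multiplier ev f"
  shows "cinner (mult_op ev f x) y = cinner x (cadjoint (mult_op ev f) y)"
proof -
  let ?M = "mult_op ev f"
  obtain C where C: "C \<ge> 0" "\<And>x. norm (?M x) \<le> C * norm x" using multiplier_bounded[OF f] by blast
  have "\<exists>g. \<forall>x. cinner (?M x) y = cinner x g" for y
  proof -
    have "cmod (cinner (?M x) y) \<le> C * norm y * norm x" for x
      using norm_cinner_le[of "?M x" y] mult_right_mono[OF C(2)[of x], of "norm y"]
      by (simp add: mult_ac)
    then obtain g where "\<And>x. x \<in> UNIV \<Longrightarrow> cinner (?M x) y = cinner x g"
      by (rule_tac riesz_csubspace[of UNIV "C * norm y" "\<lambda>x. cinner (?M x) y"])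
         (simp_all add: C(1) clinear_add[OF clinear_mult_op[OF f]]
           clinear_scaleC[OF clinear_mult_op[OF f]] cinner_simps)
    then show ?thesis by (intro exI[of _ g]) simp
  qed
  then obtain S where S: "\<And>x y. cinner (?M x) y = cinner x (S y)" by metis
  then show ?thesis using cadjoint_eqI[of ?M S] by simp
qed

lemma clinear_cadjoint:
  assumes f: "multiplier ev f"
  shows "clinear (cadjoint (mult_op ev f))"
  unfolding clinear_def
  by (intro conjI allI cinner_eqI)
     (simp_all only: cinner_simps cinner_cadjoint[OF f, symmetric])

lemma cadjoint_commute:
  assumes f: "multiplier ev f" and g: "multiplier ev g"
  shows "cadjoint (mult_op ev f) (cadjoint (mult_op ev g) x) =
    cadjoint (mult_op ev g) (cadjoint (mult_op ev f) x)"
  by (intro cinner_eqI)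
     (simp only: cinner_cadjoint[OF f, symmetric] cinner_cadjoint[OF g, symmetric] mult_op_commute[OF f g])

abbreviation M :: "'d \<Rightarrow> 'h \<Rightarrow> 'h" where
  "M j \<equiv> mult_op ev (\<lambda>z. z $ j)"

lemmas clinear_M = clinear_mult_op[OF multiplier_coord]
lemmas M_commute = mult_op_commute[OF multiplier_coord multiplier_coord]

text \<open>The identity \<open>k = 1 + \<langle>z, w\<rangle> k\<close> for \<open>k = 1 / (1 - \<langle>z, w\<rangle>)\<close>, where \<^term>\<open>kern 0\<close> is the constant function \<open>1\<close>.\<close>

lemma kern_eq_shifts:
  assumes w: "w \<in> ball 0 1"
  shows "kern w = kern 0 + (\<Sum>j\<in>UNIV. cnj (w $ j) *\<^sub>C M j (kern w))"
proof (rule ev_eqI)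
  fix z :: "complex^'d" assume z: "z \<in> ball 0 1"
  have "ev (kern 0 + (\<Sum>j\<in>UNIV. cnj (w $ j) *\<^sub>C M j (kern w))) z
      = ev (kern 0) z + (\<Sum>j\<in>UNIV. cnj (w $ j) * ev (M j (kern w)) z)"
    using z by (simp add: ev_eq_cinner cinner_simps)
  also have "\<dots> = 1 + (\<Sum>j\<in>UNIV. z $ j * cnj (w $ j)) / (1 - cdot z w)"
    using z w by (simp add: ev_mult_op[OF multiplier_coord] ev_kern sum_divide_distrib mult.commute)
       (simp add: cdot_def)
  also have "\<dots> = 1 / (1 - cdot z w)"
    using one_minus_cdot_ne_0[OF z w] by (simp add: cdot_def[symmetric] field_simps)
  finally show "ev (kern w) z = ev (kern 0 + (\<Sum>j\<in>UNIV. cnj (w $ j) *\<^sub>C M j (kern w))) z"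
    using z w by (simp add: ev_kern)
qed

text \<open>Pairing \<open>kern_eq_shifts\<close> with \<open>v\<close> gives \<open>cinner (kern w) v = c / (1 - \<langle>\<mu>, w\<rangle>)\<close>. If \<open>\<parallel>\<mu>\<parallel> \<ge> 1\<close>, the right side
grows like \<open>1 / (1 - r)\<close> along a radius towards \<open>\<mu>\<close>, but the left side is at most \<open>\<parallel>v\<parallel> \<parallel>kern w\<parallel>\<close>,
which is of order \<open>(1 - r)\<^sup>-\<^sup>1\<^sup>/\<^sup>2\<close>. So \<open>c = 0\<close>, and \<open>v\<close> vanishes on the ball.\<close>

lemma joint_eigenvalue_in_ball:
  assumes v: "v \<noteq> 0" and eig: "\<And>j x. cinner (M j x) v = \<mu> $ j * cinner x v"
  shows "\<mu> \<in> ball 0 1"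
proof (rule ccontr)
  assume "\<mu> \<notin> ball 0 1"
  then have ge: "norm \<mu> \<ge> 1" by simp
  have eq: "cinner (kern w) v * (1 - cdot \<mu> w) = cinner (kern 0) v" if "w \<in> ball 0 1" for w
  proof -
    have "cinner (kern w) v = cinner (kern 0) v + cdot \<mu> w * cinner (kern w) v"
      by (subst kern_eq_shifts[OF that])
         (simp add: cinner_simps eig cdot_def sum_distrib_left sum_distrib_right mult_ac)
    then show ?thesis by (simp add: algebra_simps)
  qed
  let ?c = "cinner (kern 0) v"
  have bound: "(cmod ?c)\<^sup>2 \<le> (1 - r) * (norm v)\<^sup>2" if r: "0 < r" "r < 1" for r
  proof -
    \<comment> \<open>On this multiple of \<open>\<mu>\<close> the inner product \<open>\<langle>\<mu>, w\<rangle>\<close> is \<open>r\<close>, while \<open>\<parallel>w\<parallel> \<le> r\<close>.\<close>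
    define w where "w = (r / (norm \<mu>)\<^sup>2) *\<^sub>R \<mu>"
    have nw: "norm w = r / norm \<mu>" using ge r by (simp add: w_def power2_eq_square)
    also have "\<dots> \<le> r"
      using ge r mult_left_mono[of 1 "norm \<mu>" r] by (intro mult_imp_div_pos_le) auto
    finally have nwr: "norm w \<le> r" .
    then have w: "w \<in> ball 0 1" using r by simp
    have "cdot \<mu> w = r"
      using ge by (auto simp: w_def cdot_scaleR_right cdot_self simp flip: of_real_power)
    then have "?c = cinner (kern w) v * complex_of_real (1 - r)" using eq[OF w] by simp
    then have "cmod ?c = cmod (cinner (kern w) v) * cmod (complex_of_real (1 - r))"
      by (simp only: norm_mult)
    then have "cmod ?c = cmod (cinner (kern w) v) * (1 - r)"
      unfolding norm_of_real using r by simp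
    also have "\<dots> \<le> norm (kern w) * norm v * (1 - r)"
      using r by (intro mult_right_mono norm_cinner_le) simp
    finally have "(cmod ?c)\<^sup>2 \<le> (norm (kern w))\<^sup>2 * (norm v)\<^sup>2 * (1 - r)\<^sup>2"
      using power_mono[of "cmod ?c" "norm (kern w) * norm v * (1 - r)" 2]
      by (simp add: power_mult_distrib)
    moreover have "(norm (kern w))\<^sup>2 \<le> 1 / (1 - r)"
    proof -
      have "complex_of_real ((norm (kern w))\<^sup>2) = complex_of_real (1 / (1 - (norm w)\<^sup>2))"
        using cinner_kern[OF w w] by (simp add: cinner_self cdot_self)
      then have "(norm (kern w))\<^sup>2 = 1 / (1 - (norm w)\<^sup>2)" using of_real_eq_iff by blast
      moreover have "(norm w)\<^sup>2 \<le> r"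
        using nwr r power2_le_imp_le mult_mono[of "norm w" r "norm w" 1] by (simp add: power2_eq_square)
      ultimately show ?thesis using r by (simp add: frac_le)
    qed
    ultimately have "(cmod ?c)\<^sup>2 \<le> 1 / (1 - r) * (norm v)\<^sup>2 * (1 - r)\<^sup>2"
      by (meson mult_right_mono order_trans zero_le_power2)
    then show ?thesis using r by (simp add: power2_eq_square mult_ac)
  qed
  have near1: "\<forall>\<^sub>F r in at_left (1::real). r \<in> {0<..<1}"
    by (rule eventually_at_left_real) simp
  have "(cmod ?c)\<^sup>2 \<le> 0"
  proof (rule tendsto_lowerbound[where F = "at_left 1"])
    show "((\<lambda>r. (1 - r) * (norm v)\<^sup>2) \<longlongrightarrow> 0) (at_left (1::real))" by (auto intro!: tendsto_eq_intros)
    show "\<forall>\<^sub>F r in at_left 1. (cmod ?c)\<^sup>2 \<le> (1 - r) * (norm v)\<^sup>2"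
      using near1 by (rule eventually_mono) (use bound in auto)
  qed simp
  then have c: "?c = 0" by simp
  have "ev v w = 0" if w: "w \<in> ball 0 1" for w
  \<comment> \<open>For \<open>\<parallel>\<mu>\<parallel> > 1\<close> the factor \<open>1 - \<langle>\<mu>, w\<rangle>\<close> can vanish inside the ball; such points are
    limits of points on the same radius where it does not.\<close>
  proof (cases "cdot \<mu> w = 1")
    case False
    then have "cinner (kern w) v = 0" using eq[OF w] c by auto
    then show ?thesis using w by (simp add: ev_eq_cinner) (metis cinner_commute complex_cnj_zero)
  next
    case True
    have "ev v (r *\<^sub>R w) = 0" if r: "0 < r" "r < 1" for r
    proof -
      have rw: "r *\<^sub>R w \<in> ball 0 1" using r w mult_strict_mono'[of r 1 "norm w" 1] by auto
      have "cdot \<mu> (r *\<^sub>R w) \<noteq> 1" using r True by (auto simp: cdot_scaleR_right)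
      then have "cinner (kern (r *\<^sub>R w)) v = 0" using eq[OF rw] c by auto
      then show ?thesis using rw by (simp add: ev_eq_cinner) (metis cinner_commute complex_cnj_zero)
    qed
    then have "\<forall>\<^sub>F r in at_left 1. ev v (r *\<^sub>R w) = 0"
      using near1 by (auto elim!: eventually_mono)
    then have "((\<lambda>r. ev v (r *\<^sub>R w)) \<longlongrightarrow> 0) (at_left 1)" by (rule tendsto_eventually)
    moreover have "((\<lambda>r. ev v (r *\<^sub>R w)) \<longlongrightarrow> ev v w) (at_left 1)"
      by (rule isCont_tendsto_compose[OF continuous_ev[OF w]]) (auto intro!: tendsto_eq_intros)
    ultimately show ?thesis using tendsto_unique trivial_limit_at_left_real by blast
  qed
  then have "v = 0" by (intro ev_eqI) (simp add: ev_eq_cinner)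
  then show False using v by simp
qed

end

section \<open>Joint spectra of compressions to coinvariant subspaces\<close>

context drury_arveson_space
begin

text \<open>The last equation is the adjoint of the one before it. This form, with multiplication operators only,
is the one used for compressions.\<close>

lemma coinvariant_projectionsD:
  assumes "P \<in> coinvariant_projections ev n"
  shows "orth_proj (blinfun_apply P)" "cdim (range P) = n"
    "multiplier ev f \<Longrightarrow> P (cadjoint (mult_op ev f) (P x)) = cadjoint (mult_op ev f) (P x)"
    "multiplier ev f \<Longrightarrow> P (mult_op ev f (P x)) = P (mult_op ev f x)"
proof -
  show P: "orth_proj (blinfun_apply P)" and "cdim (range P) = n"
    using assms by (auto simp: coinvariant_projections_def orthogonal_projection_iff)
  show *: "P (cadjoint (mult_op ev f) (P x)) = cadjoint (mult_op ev f) (P x)"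
    if "multiplier ev f" for x
    using assms that by (auto simp: coinvariant_projections_def)
  assume f: "multiplier ev f"
  show "P (mult_op ev f (P x)) = P (mult_op ev f x)"
    by (rule cinner_eqI_left) (simp add: orth_projD(3)[OF P] cinner_cadjoint[OF f] *[OF f])
qed

lemma coinvariant_projectionsI:
  assumes P: "orth_proj (blinfun_apply P)" "cdim (range P) = n"
    and inv: "\<And>f x. multiplier ev f \<Longrightarrow> P (mult_op ev f (P x)) = P (mult_op ev f x)"
  shows "P \<in> coinvariant_projections ev n"
proof -
  have "P (cadjoint (mult_op ev f) (P x)) = cadjoint (mult_op ev f) (P x)" if f: "multiplier ev f" for f x
  proof (rule cinner_eqI)
    fix y
    have "cinner y (P (cadjoint (mult_op ev f) (P x))) = cinner (P (mult_op ev f (P y))) x"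
      by (simp add: orth_projD(3)[OF P(1)] cinner_cadjoint[OF f])
    also have "\<dots> = cinner y (cadjoint (mult_op ev f) (P x))"
      by (simp add: inv[OF f]) (simp add: orth_projD(3)[OF P(1)] cinner_cadjoint[OF f])
    finally show "cinner y (P (cadjoint (mult_op ev f) (P x))) = cinner y (cadjoint (mult_op ev f) (P x))" .
  qed
  then show ?thesis using P by (simp add: coinvariant_projections_def orthogonal_projection_iff)
qed

lemma exists_triangular_basis:
  assumes P: "P \<in> coinvariant_projections ev n" and n: "n \<ge> 1"
  shows "\<exists>es \<mu>s. triangular M es \<mu>s \<and> cspan (set es) = range P"
proof -
  obtain B where B: "range P \<subseteq> cspan B" "card B = cdim (range P)"
    by (rule complex_vector.basis_exists[of "range P"])
  have "finite B" using B(2) coinvariant_projectionsD(2)[OF P] n card_ge_0_finite by force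
  then have dim: "dim_at_most (card B) (range P)"
    using dim_at_most_mono[OF dim_at_most_cspan B(1)] by blast
  show ?thesis
    by (rule schur_triangularization[OF clinear_M M_commute coinvariant_projectionsD(1)[OF P] _ dim])
       (rule coinvariant_projectionsD(4)[OF P multiplier_coord])
qed

text \<open>The compressions form a triangular commuting tuple, whose joint spectrum is known. For the position of
the points, reverse the basis: it is then triangular for the adjoints of the \<open>M j\<close>, which leave its
span invariant, so each conjugated diagonal point belongs to a joint eigenvector of the adjoints.\<close>

lemma Psi_triangular:
  assumes P: "P \<in> coinvariant_projections ev n"
    and tri: "triangular M es \<mu>s" and span: "cspan (set es) = range P"
  shows "Psi ev P = mset \<mu>s" "length es = n" "set \<mu>s \<subseteq> ball 0 1"
proof -
  note PD = coinvariant_projectionsD[OF P] and op = orth_projD[OF coinvariant_projectionsD(1)[OF P]]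
  have orth: "orthonormal_list es" and len: "length \<mu>s = length es" using tri by (auto simp: triangular_def)
  have fix_P: "P v = v" if "v \<in> cspan (set es)" for v
    by (rule orth_proj_fixes[OF PD(1) that[unfolded span]])
  have inP: "P x \<in> cspan (set es)" for x unfolding span by (rule rangeI)
  interpret C: triangular_tuple "compressed_shift ev P" es \<mu>s
  proof
    show "clinear (compressed_shift ev P j)" for j
      using clinear_M[of j] op(1) by (simp add: clinear_def compressed_shift_def)
    show "compressed_shift ev P j v \<in> cspan (set es)" for v j
      by (simp add: compressed_shift_def inP)
    show "compressed_shift ev P j (compressed_shift ev P k v) = compressed_shift ev P k (compressed_shift ev P j v)"
      for v j k
      by (simp add: compressed_shift_def PD(4)[OF multiplier_coord] M_commute[of j])
    have "cinner (compressed_shift ev P j x) (es ! i) = cinner (M j x) (es ! i)" if "i < length es" for j x i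
      using fix_P[of "es ! i"] that
      by (simp add: compressed_shift_def op(3) complex_vector.span_base)
    then show "triangular (compressed_shift ev P) es \<mu>s" using tri by (simp add: triangular_def)
  qed
  show "Psi ev P = mset \<mu>s"
    using C.joint_spectrum_mset_eq by (simp add: Psi_def span)
  show "length es = n" using cdim_orthonormal[OF orth] PD(2) span by simp
  have cadj_in: "cadjoint (M j) v \<in> cspan (set es)" if "v \<in> cspan (set es)" for j v
    using PD(3)[OF multiplier_coord, of j v] fix_P[OF that] inP by metis
  let ?A = "\<lambda>j. cadjoint (M j)"
  let ?conj = "\<lambda>\<mu> :: complex^'d. \<chi> j. cnj (\<mu> $ j)"
  have A_entry: "cinner (?A j x) y = cnj (cinner (M j y) x)" for j x y
    using cinner_cadjoint[OF multiplier_coord, of j y x] cinner_commute by metis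
  interpret A: triangular_tuple ?A "rev es" "map ?conj (rev \<mu>s)"
  proof
    show "clinear (?A j)" for j by (rule clinear_cadjoint[OF multiplier_coord])
    show "?A j v \<in> cspan (set (rev es))" if "v \<in> cspan (set (rev es))" for v j
      using cadj_in that by simp
    show "?A j (?A k v) = ?A k (?A j v)" for v j k
      by (rule cadjoint_commute[OF multiplier_coord multiplier_coord])
    show "triangular ?A (rev es) (map ?conj (rev \<mu>s))"
      using tri orthonormal_list_rev[OF orth] len
      by (auto simp: triangular_def A_entry rev_nth)
  qed
  show "set \<mu>s \<subseteq> ball 0 1"
  proof
    fix \<mu> assume "\<mu> \<in> set \<mu>s"
    then have "?conj \<mu> \<in> joint_spectrum (cspan (set (rev es))) ?A"
      unfolding A.joint_spectrum_eq by auto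
    then obtain v where v: "v \<noteq> 0" "\<And>j. ?A j v = cnj (\<mu> $ j) *\<^sub>C v"
      unfolding A.joint_spectrum_iff A.shift_def by auto
    have "cinner (M j x) v = \<mu> $ j * cinner x v" for j x
      by (simp add: cinner_cadjoint[OF multiplier_coord] v(2) cinner_simps)
    then show "\<mu> \<in> ball 0 1" by (rule joint_eigenvalue_in_ball[OF v(1)])
  qed
qed

end

section \<open>Continuity\<close>

lemma common_subsequence:
  fixes f :: "'i \<Rightarrow> nat \<Rightarrow> complex"
  assumes "finite I" "\<And>i. i \<in> I \<Longrightarrow> bounded (range (f i))"
  shows "\<exists>r. strict_mono r \<and> (\<forall>i\<in>I. \<exists>l. (\<lambda>k. f i (r k)) \<longlonglongrightarrow> l)"
  using assms
proof (induction I rule: finite_induct)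
  case empty
  then show ?case using strict_mono_id by blast
next
  case (insert i I)
  then obtain r where r: "strict_mono r" "\<forall>i\<in>I. \<exists>l. (\<lambda>k. f i (r k)) \<longlonglongrightarrow> l" by auto
  have "bounded (range (f i \<circ> r))"
    by (rule bounded_subset[of "range (f i)"]) (use insert.prems in auto)
  then obtain l s where s: "strict_mono s" "((f i \<circ> r) \<circ> s) \<longlonglongrightarrow> l"
    using bounded_imp_convergent_subsequence by blast
  have "\<exists>l. (\<lambda>k. f k' ((r \<circ> s) k)) \<longlonglongrightarrow> l" if k': "k' \<in> insert i I" for k'
  proof (cases "k' = i")
    case False
    then obtain l where "(\<lambda>k. f k' (r k)) \<longlonglongrightarrow> l" using k' r(2) by auto
    then have "((\<lambda>k. f k' (r k)) \<circ> s) \<longlonglongrightarrow> l" using s(1) by (rule LIMSEQ_subseq_LIMSEQ)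
    then show ?thesis by (auto simp: o_def)
  qed (use s(2) in \<open>auto simp: o_def\<close>)
  moreover have "strict_mono (r \<circ> s)" using r(1) s(1) by (rule strict_mono_o)
  ultimately show ?case by blast
qed

lemma pseudohyp_dist_tendsto_0:
  fixes x :: "complex^'d"
  assumes x: "x \<in> ball 0 1" and y: "y \<longlonglongrightarrow> x"
  shows "(\<lambda>k. pseudohyp_dist x (y k)) \<longlonglongrightarrow> 0"
proof -
  have c: "(\<lambda>k. cdot x (y k)) \<longlonglongrightarrow> cdot x x"
    unfolding cdot_def by (intro tendsto_intros y)
  have ne: "1 - cdot x x \<noteq> 0" using one_minus_cdot_ne_0[OF x x] .
  have "(\<lambda>k. pseudohyp_dist x (y k)) \<longlonglongrightarrow> pseudohyp_dist x x"
    unfolding pseudohyp_dist_def by (intro tendsto_intros y c) (use ne in auto)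
  moreover have "pseudohyp_dist x x = 0"
  proof -
    have "(norm x)\<^sup>2 < 1" using x by (simp add: abs_square_less_1)
    moreover have "cmod (1 - cdot x x) = \<bar>1 - (norm x)\<^sup>2\<bar>"
      by (metis cdot_self norm_of_real of_real_1 of_real_diff)
    ultimately show ?thesis by (simp add: pseudohyp_dist_def power2_eq_square)
  qed
  ultimately show ?thesis by simp
qed

text \<open>The distance between multisets is defined with arbitrarily chosen orderings; composing the permutations that
lead from these to \<open>xs\<close> and \<open>ys\<close> gives a competitor in the minimum.\<close>

lemma sym_dist_less:
  assumes len: "length xs = length ys" and ne: "xs \<noteq> []"
    and less: "\<And>i. i < length xs \<Longrightarrow> pseudohyp_dist (xs ! i) (ys ! i) < r"
  shows "sym_dist (mset xs) (mset ys) < r"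
proof -
  define xs' where "xs' = (SOME zs. mset zs = mset xs)"
  define ys' where "ys' = (SOME zs. mset zs = mset ys)"
  have xs': "mset xs' = mset xs" unfolding xs'_def by (rule someI) (rule refl)
  have ys': "mset ys' = mset ys" unfolding ys'_def by (rule someI) (rule refl)
  obtain p where p: "p permutes {..<length xs}" "permute_list p xs = xs'"
    using mset_eq_permutation[OF xs'] by blast
  obtain q where q: "q permutes {..<length ys'}" "permute_list q ys' = ys"
    using mset_eq_permutation[OF ys'[symmetric]] by blast
  define n where "n = length xs"
  have n: "length xs = n" "length ys = n" "length xs' = n" "length ys' = n" "n > 0"
    using len ne xs' ys' by (auto simp: n_def dest: mset_eq_length)
  have pn: "p permutes {..<n}" and qn: "q permutes {..<n}" using p q n by auto
  have dist: "pseudohyp_dist (xs' ! i) (ys' ! (q \<circ> p) i) < r" if i: "i < n" for i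
  proof -
    have pi: "p i < n" using permutes_in_image[OF pn] i by (auto simp: lessThan_iff)
    have "xs' ! i = xs ! p i" using p n i permute_list_nth by metis
    moreover have "ys ! p i = ys' ! q (p i)" using q n pi permute_list_nth by metis
    ultimately show ?thesis using less[of "p i"] pi n by simp
  qed
  have "tuple_dist xs' ys' \<le> Max ((\<lambda>j. pseudohyp_dist (xs' ! j) (ys' ! (q \<circ> p) j)) ` {..<length xs'})"
    unfolding tuple_dist_def n
  proof (rule Min_le)
    show "finite ((\<lambda>\<sigma>. Max ((\<lambda>j. pseudohyp_dist (xs' ! j) (ys' ! \<sigma> j)) ` {..<n})) ` {\<sigma>. \<sigma> permutes {..<n}})"
      by (intro finite_imageI finite_permutations) simp
    show "Max ((\<lambda>j. pseudohyp_dist (xs' ! j) (ys' ! (q \<circ> p) j)) ` {..<n})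
      \<in> (\<lambda>\<sigma>. Max ((\<lambda>j. pseudohyp_dist (xs' ! j) (ys' ! \<sigma> j)) ` {..<n})) ` {\<sigma>. \<sigma> permutes {..<n}}"
      using permutes_compose[OF pn qn] by (intro image_eqI[of _ _ "q \<circ> p"]) auto
  qed
  also have "\<dots> < r"
    using n dist by (subst Max_less_iff) auto
  finally show ?thesis by (simp add: sym_dist_def xs'_def ys'_def)
qed

lemma topspace_sym_polyball_topology [simp]:
  "topspace (sym_polyball_topology n) = sym_polyball n"
proof -
  have "openin (sym_polyball_topology n) (sym_polyball n)"
    by (auto simp: openin_sym_polyball_topology intro: exI[of _ 1])
  then show ?thesis
    using openin_subset openin_topspace openin_sym_polyball_topology by (metis subset_antisym)
qed

context drury_arveson_space
begin

lemma tendsto_M: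
  assumes "(f \<longlongrightarrow> a) F"
  shows "((\<lambda>k. M j (f k)) \<longlongrightarrow> M j a) F"
proof -
  obtain C where "\<And>x. norm (M j x) \<le> C * norm x" using multiplier_bounded[OF multiplier_coord] by blast
  then have "bounded_linear (M j)" by (rule bounded_linear_clinear[OF clinear_M])
  then show ?thesis using assms by (rule bounded_linear.tendsto)
qed

text \<open>The \<open>i\<close>-th basis vectors for \<open>Q k\<close> differ from their images under \<open>P\<close> by at most
\<open>\<parallel>Q k - P\<parallel>\<close>, and these images have bounded coordinates in a fixed finite basis of the range of \<open>P\<close>. So they converge along a
subsequence, all \<open>i\<close> at once. That the limits span the range of \<open>P\<close> follows from
\<open>Q k v = list_proj (es k) v\<close>, which passes to the limit as well.\<close>

lemma triangular_limit:
  assumes P: "P \<in> coinvariant_projections ev n" and n: "n \<ge> 1"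
    and Q: "\<And>k. Q k \<in> coinvariant_projections ev n" and lim: "Q \<longlonglongrightarrow> P"
    and tri: "\<And>k. triangular M (es k) (\<mu>s k)" and span: "\<And>k. cspan (set (es k)) = range (Q k)"
  shows "\<exists>r e \<mu>. strict_mono r \<and> triangular M e \<mu> \<and> cspan (set e) = range P \<and>
    (\<forall>i<n. (\<lambda>k. \<mu>s (r k) ! i) \<longlonglongrightarrow> \<mu> ! i)"
proof -
  note PD = coinvariant_projectionsD[OF P] and op = orth_projD[OF coinvariant_projectionsD(1)[OF P]]
  have orth: "orthonormal_list (es k)" for k using tri by (simp add: triangular_def)
  have len: "length (es k) = n" for k using Psi_triangular(2)[OF Q tri span] .
  have unit: "norm (es k ! i) = 1" if "i < n" for k i
  proof -
    have "complex_of_real ((norm (es k ! i))\<^sup>2) = complex_of_real 1"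
      unfolding cinner_self[symmetric] using orth[of k] that len[of k]
      by (simp add: orthonormal_list_def)
    then have "(norm (es k ! i))\<^sup>2 = 1" using of_real_eq_iff by blast
    then show ?thesis using norm_ge_zero[of "es k ! i"] by (auto simp: power2_eq_1_iff)
  qed
  obtain bs \<nu>s where bs: "triangular M bs \<nu>s" "cspan (set bs) = range P"
    using exists_triangular_basis[OF P n] by blast
  have bs_orth: "orthonormal_list bs" using bs by (simp add: triangular_def)
  have P_bs: "blinfun_apply P = list_proj bs"
    by (rule orth_proj_unique[OF PD(1) orth_proj_list_proj[OF bs_orth]])
       (simp add: bs(2) range_list_proj[OF bs_orth])
  define c where "c = (\<lambda>(i, l) k. cinner (es k ! i) (bs ! l))"
  have "bounded (range (c p))" if "p \<in> {..<n} \<times> {..<length bs}" for p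
  proof -
    obtain i l where p: "p = (i, l)" "i < n" using \<open>p \<in> {..<n} \<times> {..<length bs}\<close> by auto
    have "cmod (c p k) \<le> norm (bs ! l)" for k
      using norm_cinner_le[of "es k ! i" "bs ! l"] unit[OF p(2)] by (simp add: c_def p)
    then show ?thesis by (auto simp: bounded_iff)
  qed
  then obtain r where r: "strict_mono r"
    "\<And>p. p \<in> {..<n} \<times> {..<length bs} \<Longrightarrow> \<exists>x. (\<lambda>k. c p (r k)) \<longlonglongrightarrow> x"
    using common_subsequence[of "{..<n} \<times> {..<length bs}" c] by auto
  obtain x where x: "\<And>p. p \<in> {..<n} \<times> {..<length bs} \<Longrightarrow> (\<lambda>k. c p (r k)) \<longlonglongrightarrow> x p"
    using r(2) by metis
  have Qr: "(\<lambda>k. Q (r k)) \<longlonglongrightarrow> P" using LIMSEQ_subseq_LIMSEQ[OF lim r(1)] by (simp add: o_def)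
  define e where "e = map (\<lambda>i. \<Sum>l<length bs. x (i, l) *\<^sub>C bs ! l) [0..<n]"
  have len_e: "length e = n" by (simp add: e_def)
  have es_lim: "(\<lambda>k. es (r k) ! i) \<longlonglongrightarrow> e ! i" if i: "i < n" for i
  proof -
    have "(\<lambda>k. \<Sum>l<length bs. c (i, l) (r k) *\<^sub>C bs ! l) \<longlonglongrightarrow> (\<Sum>l<length bs. x (i, l) *\<^sub>C bs ! l)"
      using x i by (intro tendsto_sum tendsto_scaleC tendsto_const) auto
    then have 1: "(\<lambda>k. P (es (r k) ! i)) \<longlonglongrightarrow> e ! i"
      using i by (simp add: P_bs list_proj_def c_def e_def)
    have Q_fix: "Q k (es k ! i) = es k ! i" for k
    proof -
      have "es k ! i \<in> range (Q k)"
        using len[of k] i by (auto simp flip: span intro: complex_vector.span_base)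
      then show ?thesis using orth_proj_fixes[OF coinvariant_projectionsD(1)[OF Q]] by blast
    qed
    have "norm (es (r k) ! i - P (es (r k) ! i)) \<le> norm (Q (r k) - P)" for k
    proof -
      have "es (r k) ! i - P (es (r k) ! i) = (Q (r k) - P) (es (r k) ! i)"
        by (simp add: blinfun.diff_left Q_fix)
      then show ?thesis using norm_blinfun[of "Q (r k) - P" "es (r k) ! i"] unit[OF i] by simp
    qed
    moreover have "(\<lambda>k. norm (Q (r k) - P)) \<longlonglongrightarrow> 0"
      using Qr by (simp add: LIM_zero tendsto_norm_zero)
    ultimately have "(\<lambda>k. es (r k) ! i - P (es (r k) ! i)) \<longlonglongrightarrow> 0"
      by (rule_tac tendsto_norm_zero_cancel, rule_tac tendsto_sandwich[OF _ _ tendsto_const]) auto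
    from tendsto_add[OF this 1] show ?thesis by simp
  qed
  have orth_e: "orthonormal_list e"
    unfolding orthonormal_list_def len_e
  proof (intro allI impI)
    fix i l assume il: "i < n" "l < n"
    have "(\<lambda>k. cinner (es (r k) ! i) (es (r k) ! l)) \<longlonglongrightarrow> cinner (e ! i) (e ! l)"
      by (intro tendsto_cinner es_lim il)
    moreover have "cinner (es (r k) ! i) (es (r k) ! l) = (if i = l then 1 else 0)" for k
      using orth[of "r k"] il len[of "r k"] by (simp add: orthonormal_list_def)
    ultimately have "(\<lambda>k. if i = l then 1 else 0) \<longlonglongrightarrow> cinner (e ! i) (e ! l)" by (simp only:)
    then show "cinner (e ! i) (e ! l) = (if i = l then 1 else 0)" by (simp only: LIMSEQ_const_iff)
  qed
  define \<mu> where "\<mu> = map (\<lambda>i. \<chi> j. cinner (M j (e ! i)) (e ! i)) [0..<n]"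
  have entry_lim: "(\<lambda>k. cinner (M j (es (r k) ! i)) (es (r k) ! l)) \<longlonglongrightarrow> cinner (M j (e ! i)) (e ! l)"
    if "i < n" "l < n" for i l j
    by (intro tendsto_cinner tendsto_M es_lim that)
  have tri_e: "triangular M e \<mu>"
    unfolding triangular_def len_e
  proof (intro conjI allI impI)
    fix j i l assume il: "i < n" "l < n" "i < l"
    have "cinner (M j (es (r k) ! i)) (es (r k) ! l) = 0" for k
      using tri[of "r k"] il len[of "r k"] by (simp add: triangular_def)
    then show "cinner (M j (e ! i)) (e ! l) = 0"
      using entry_lim[OF il(1,2), of j] by (simp add: LIMSEQ_const_iff)
  qed (auto simp: \<mu>_def orth_e)
  have "(\<lambda>k. \<mu>s (r k) ! i) \<longlonglongrightarrow> \<mu> ! i" if i: "i < n" for i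
  proof (rule vec_tendstoI)
    fix j
    have "\<mu>s (r k) ! i $ j = cinner (M j (es (r k) ! i)) (es (r k) ! i)" for k
      using tri[of "r k"] i len[of "r k"] by (simp add: triangular_def)
    then show "(\<lambda>k. \<mu>s (r k) ! i $ j) \<longlonglongrightarrow> \<mu> ! i $ j"
      using entry_lim[OF i i, of j] i by (simp add: \<mu>_def)
  qed
  moreover have "cspan (set e) = range P"
  proof -
    have "P v = list_proj e v" for v
    proof (rule LIMSEQ_unique)
      show "(\<lambda>k. Q (r k) v) \<longlonglongrightarrow> P v" by (intro blinfun.tendsto Qr tendsto_const)
      have "blinfun_apply (Q k) = list_proj (es k)" for k
        by (rule orth_proj_unique[OF coinvariant_projectionsD(1)[OF Q] orth_proj_list_proj[OF orth]])
           (simp add: span range_list_proj[OF orth])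
      moreover have "(\<lambda>k. list_proj (es (r k)) v) \<longlonglongrightarrow> list_proj e v"
        unfolding list_proj_def len len_e
        by (intro tendsto_sum tendsto_scaleC tendsto_cinner tendsto_const es_lim) auto
      ultimately show "(\<lambda>k. Q (r k) v) \<longlonglongrightarrow> list_proj e v" by simp
    qed
    then show ?thesis using range_list_proj[OF orth_e] by auto
  qed
  ultimately show ?thesis using r(1) tri_e by blast
qed

lemma Psi_in_sym_polyball:
  assumes P: "P \<in> coinvariant_projections ev n" and n: "n \<ge> 1"
  shows "Psi ev P \<in> sym_polyball n"
proof -
  obtain es \<mu>s where es: "triangular M es \<mu>s" "cspan (set es) = range P"
    using exists_triangular_basis[OF P n] by blast
  then show ?thesis
    using Psi_triangular[OF P es] by (simp add: sym_polyball_def triangular_def)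
qed

text \<open>If \<open>\<Psi>\<close> failed to be continuous at \<open>P\<close>, a sequence \<open>Q k \<longlonglongrightarrow> P\<close> would have all its images outside a
neighbourhood of \<open>\<Psi>(P)\<close>, but \<open>triangular_limit\<close> provides a subsequence whose images converge to \<open>\<Psi>(P)\<close>.\<close>

lemma continuous_Psi:
  assumes n: "n \<ge> 1"
  shows "continuous_map (top_of_set (coinvariant_projections ev n))
    (sym_polyball_topology n) (Psi ev)"
  unfolding continuous_map_def
proof (intro conjI allI impI)
  let ?C = "coinvariant_projections ev n"
  show "Psi ev \<in> topspace (top_of_set ?C) \<rightarrow> topspace (sym_polyball_topology n)"
    using Psi_in_sym_polyball[OF _ n] by simp
  fix U :: "(complex^'d) multiset set" assume U: "openin (sym_polyball_topology n) U"
  have "\<exists>\<delta>>0. \<forall>Q\<in>?C. dist Q P < \<delta> \<longrightarrow> Psi ev Q \<in> U" if P: "P \<in> ?C" "Psi ev P \<in> U" for P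
  proof (rule ccontr)
    assume "\<not> ?thesis"
    then have "\<exists>Q\<in>?C. dist Q P < \<delta> \<and> Psi ev Q \<notin> U" if "\<delta> > 0" for \<delta> using that by blast
    then have "\<exists>Q\<in>?C. dist Q P < 1 / Suc k \<and> Psi ev Q \<notin> U" for k by simp
    then obtain Q where Q: "\<And>k. Q k \<in> ?C" "\<And>k. dist (Q k) P < 1 / Suc k" "\<And>k. Psi ev (Q k) \<notin> U"
      by metis
    have "(\<lambda>k. dist (Q k) P) \<longlonglongrightarrow> 0"
    proof (rule tendsto_sandwich[OF _ _ tendsto_const])
      show "(\<lambda>k. 1 / real (Suc k)) \<longlonglongrightarrow> 0"
        using LIMSEQ_inverse_real_of_nat by (simp add: inverse_eq_divide)
    qed (use Q(2) in \<open>auto intro!: always_eventually less_imp_le simp del: of_nat_Suc\<close>)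
    then have lim: "Q \<longlonglongrightarrow> P" by (subst tendsto_dist_iff)
    obtain es \<mu>s where es: "\<And>k. triangular M (es k) (\<mu>s k)" "\<And>k. cspan (set (es k)) = range (Q k)"
      using exists_triangular_basis[OF Q(1) n] by metis
    obtain r e \<mu> where e: "triangular M e \<mu>" "cspan (set e) = range P"
      "\<And>i. i < n \<Longrightarrow> (\<lambda>k. \<mu>s (r k) ! i) \<longlonglongrightarrow> \<mu> ! i"
      using triangular_limit[OF P(1) n Q(1) lim es] by blast
    have \<mu>: "Psi ev P = mset \<mu>" "length \<mu> = n" "set \<mu> \<subseteq> ball 0 1"
      using Psi_triangular[OF P(1) e(1,2)] e(1) by (auto simp: triangular_def)
    have \<mu>s: "Psi ev (Q k) = mset (\<mu>s k)" "length (\<mu>s k) = n" for k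
      using Psi_triangular[OF Q(1) es] es(1)[of k] by (auto simp: triangular_def)
    obtain \<rho> where \<rho>: "\<rho> > 0" "{Y \<in> sym_polyball n. sym_dist (Psi ev P) Y < \<rho>} \<subseteq> U"
      using U P(2) unfolding openin_sym_polyball_topology by blast
    have "\<forall>\<^sub>F k in sequentially. \<forall>i\<in>{..<n}. pseudohyp_dist (\<mu> ! i) (\<mu>s (r k) ! i) < \<rho>"
    proof (intro eventually_ball_finite ballI)
      fix i assume "i \<in> {..<n}"
      then have "(\<lambda>k. pseudohyp_dist (\<mu> ! i) (\<mu>s (r k) ! i)) \<longlonglongrightarrow> 0"
        using \<mu> e(3) by (intro pseudohyp_dist_tendsto_0) (auto simp: subset_iff)
      then show "\<forall>\<^sub>F k in sequentially. pseudohyp_dist (\<mu> ! i) (\<mu>s (r k) ! i) < \<rho>"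
        using \<rho>(1) by (rule order_tendstoD(2))
    qed simp
    then obtain k where k: "\<And>i. i < n \<Longrightarrow> pseudohyp_dist (\<mu> ! i) (\<mu>s (r k) ! i) < \<rho>"
      using eventually_happens'[OF sequentially_bot] by fastforce
    have "sym_dist (mset \<mu>) (mset (\<mu>s (r k))) < \<rho>"
      by (rule sym_dist_less) (use k \<mu> \<mu>s n in auto)
    then have "Psi ev (Q (r k)) \<in> U"
      using \<rho>(2) \<mu>(1) \<mu>s(1) Psi_in_sym_polyball[OF Q(1) n] by auto
    then show False using Q(3) by blast
  qed
  then show "openin (top_of_set ?C) {P \<in> topspace (top_of_set ?C). Psi ev P \<in> U}"
    by (auto simp: openin_euclidean_subtopology_iff)
qed

end

section \<open>Surjectivity\<close>

lemma norm_axis: "norm (axis j t :: complex^'d) = cmod t"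
proof -
  have "norm (axis j t :: complex^'d) = sqrt (\<Sum>i\<in>UNIV. if i = j then (cmod t)\<^sup>2 else 0)"
    unfolding norm_vec_def L2_set_def axis_def by (intro arg_cong[of _ _ sqrt] sum.cong) auto
  then show ?thesis by simp
qed

text \<open>The limit is read off from the power series divided by \<open>t\<^sup>m\<close>.\<close>

lemma holomorphic_leading_limit:
  fixes f :: "complex \<Rightarrow> complex"
  assumes f: "f holomorphic_on ball 0 \<delta>" and \<delta>: "\<delta> > 0"
    and zero: "\<And>k. k < m \<Longrightarrow> (deriv ^^ k) f 0 = 0"
  shows "((\<lambda>t. f t / t ^ m) \<longlongrightarrow> (deriv ^^ m) f 0 / fact m) (at 0)"
proof -
  let ?a = "\<lambda>k. (deriv ^^ k) f 0 / fact k"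
  have "(\<lambda>k. ?a (k + m) * t ^ k) sums (f t / t ^ m)" if t: "t \<noteq> 0" "norm t < \<delta>" for t
  proof -
    have "(\<lambda>k. ?a k * t ^ k) sums f t"
      using holomorphic_power_series[OF f, of t] t by simp
    then have "(\<lambda>k. ?a (k + m) * t ^ (k + m)) sums (f t - (\<Sum>k<m. ?a k * t ^ k))"
      by (rule sums_split_initial_segment)
    moreover have "(\<Sum>k<m. ?a k * t ^ k) = 0" using zero by simp
    ultimately have "(\<lambda>k. ?a (k + m) * t ^ (k + m) / t ^ m) sums (f t / t ^ m)"
      by (intro sums_divide) simp
    then show ?thesis using t(1) by (simp add: power_add)
  qed
  then have "((\<lambda>t. f t / t ^ m) \<longlongrightarrow> ?a (0 + m)) (at 0)"
    by (rule powser_limit_0_strong[OF \<delta>])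
  then show ?thesis by simp
qed

context drury_arveson_space
begin

definition axis_line :: "'d \<Rightarrow> complex^'d \<Rightarrow> complex \<Rightarrow> complex^'d" where
  "axis_line j \<nu> t = \<nu> + axis j t"

lemma axis_line_in_ball: "cmod t < 1 - norm \<nu> \<Longrightarrow> axis_line j \<nu> t \<in> ball 0 1"
  using norm_triangle_ineq[of \<nu> "axis j t"] by (simp add: axis_line_def norm_axis)

lemma holomorphic_on_axis_line:
  "(\<lambda>t. ev h (axis_line j \<nu> t)) holomorphic_on ball 0 (1 - norm \<nu>)"
proof (rule holomorphic_onI)
  fix t :: complex assume "t \<in> ball 0 (1 - norm \<nu>)"
  then have "axis_line j \<nu> t \<in> ball 0 1" by (intro axis_line_in_ball) simp
  then obtain L where L: "(ev h has_derivative L) (at (axis_line j \<nu> t))" "\<And>c v. L (c *s v) = c * L v"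
    using da unfolding drury_arveson_def holomorphic_several_def by blast
  have ax: "axis j s = s *s axis j 1" for s :: complex
    by (simp add: vec_eq_iff axis_def)
  have "bounded_linear (\<lambda>s :: complex. axis j s :: complex^'d)"
    by (rule bounded_linear_intro[of _ 1]) (auto simp: vec_eq_iff axis_def norm_axis[unfolded axis_def])
  then have "(axis_line j \<nu> has_derivative (\<lambda>s. axis j s)) (at t)"
    unfolding axis_line_def[abs_def]
    using has_derivative_add[OF has_derivative_const bounded_linear.has_derivative[OF _ has_derivative_ident]]
    by fastforce
  then have "((\<lambda>t. ev h (axis_line j \<nu> t)) has_derivative (\<lambda>s. L (axis j s))) (at t)"
    using L(1) by (rule has_derivative_compose)
  moreover have "(\<lambda>s. L (axis j s)) = (*) (L (axis j 1))"
    by (subst ax) (auto simp: L(2))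
  ultimately have "((\<lambda>t. ev h (axis_line j \<nu> t)) has_field_derivative L (axis j 1)) (at t)"
    by (simp add: has_field_derivative_def)
  then show "(\<lambda>t. ev h (axis_line j \<nu> t)) field_differentiable at t within ball 0 (1 - norm \<nu>)"
    using field_differentiable_at_within field_differentiable_def by blast
qed

text \<open>Kernel functions are eigenvectors of the adjoint of \<open>M j\<close>, and the eigenvalues that such
vectors of the span can have are on the diagonal. To find the position, compare coordinates at the first
index \<open>i\<close> where \<open>kern w\<close> has a nonzero one: the other terms of \<open>cinner (M j (es ! i)) (kern w)\<close> drop
out, those before \<open>i\<close> by the choice of \<open>i\<close> and those after \<open>i\<close> by triangularity.\<close>

lemma kern_in_span_coord:
  assumes tri: "triangular M es \<mu>s" and w: "w \<in> ball 0 1" and span: "kern w \<in> cspan (set es)"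
  shows "\<exists>i<length es. \<mu>s ! i $ j = w $ j"
proof -
  have orth: "orthonormal_list es" using tri by (simp add: triangular_def)
  have kM: "cinner (M j x) (kern w) = w $ j * cinner x (kern w)" for x
    using ev_mult_op[OF multiplier_coord w] w by (simp add: ev_eq_cinner)
  have "(0::complex^'d) \<in> ball 0 1" by simp
  then have "cinner (kern 0) (kern w) = 1"
    using cinner_kern[OF w, of 0] by (simp add: cdot_def)
  then have "kern w \<noteq> 0" by auto
  then have "\<exists>i. i < length es \<and> cinner (kern w) (es ! i) \<noteq> 0"
    using span_eqI_coords[OF orth span] by blast
  then obtain i where i: "i < length es" "cinner (kern w) (es ! i) \<noteq> 0"
    and min: "\<And>l. l < i \<Longrightarrow> cinner (kern w) (es ! l) = 0"
    using exists_least_iff[of "\<lambda>i. i < length es \<and> cinner (kern w) (es ! i) \<noteq> 0"]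
    by (metis less_trans)
  have "cinner (M j (es ! i)) (kern w)
      = (\<Sum>l<length es. cnj (cinner (kern w) (es ! l)) * cinner (M j (es ! i)) (es ! l))"
    by (subst list_proj_fixes[OF orth span, symmetric]) (simp add: list_proj_def cinner_simps)
  also have "\<dots> = (\<Sum>l<length es. if l = i then cnj (cinner (kern w) (es ! i)) * \<mu>s ! i $ j else 0)"
  proof (rule sum.cong)
    fix l assume "l \<in> {..<length es}"
    then show "cnj (cinner (kern w) (es ! l)) * cinner (M j (es ! i)) (es ! l)
        = (if l = i then cnj (cinner (kern w) (es ! i)) * \<mu>s ! i $ j else 0)"
      using tri i min[of l] by (cases l i rule: linorder_cases) (auto simp: triangular_def)
  qed simp
  also have "\<dots> = cinner (es ! i) (kern w) * \<mu>s ! i $ j"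
    using i(1) by (simp flip: cinner_commute)
  finally have "w $ j * cinner (es ! i) (kern w) = cinner (es ! i) (kern w) * \<mu>s ! i $ j"
    by (simp add: kM)
  moreover have "cinner (es ! i) (kern w) \<noteq> 0" using i(2) cinner_eq_0_commute by blast
  ultimately show ?thesis using i(1) by auto
qed

definition perp :: "'h list \<Rightarrow> 'h set" where
  "perp es = {x. \<forall>e\<in>set es. cinner x e = 0}"

text \<open>Invariance of the orthogonal complement under all multipliers is coinvariance of the span; this form does
not involve adjoints.\<close>

definition coinvariant_flag :: "'h list \<Rightarrow> (complex^'d) list \<Rightarrow> bool" where
  "coinvariant_flag es \<mu>s \<longleftrightarrow> triangular M es \<mu>s \<and>
    (\<forall>f x. multiplier ev f \<longrightarrow> x \<in> perp es \<longrightarrow> mult_op ev f x \<in> perp es)"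

lemma minus_list_proj_perp: "orthonormal_list es \<Longrightarrow> x - list_proj es x \<in> perp es"
  by (auto simp: perp_def cinner_simps in_set_conv_nth cinner_list_proj)

lemma list_proj_perp: "x \<in> perp es \<Longrightarrow> list_proj es x = 0"
  by (simp add: list_proj_def perp_def)

text \<open>The vector \<open>g\<close> represents the leading coefficient at \<open>\<nu>\<close> of functions in \<^term>\<open>perp es\<close> along a line
through \<open>\<nu>\<close>, the order being the least that occurs. A multiplier \<open>f\<close> multiplies this coefficient
by \<open>f \<nu>\<close>, because \<open>f\<close> is continuous.\<close>

lemma extension_vector:
  assumes flag: "coinvariant_flag es \<mu>s" and \<nu>: "\<nu> \<in> ball 0 1"
  shows "\<exists>g\<in>perp es. cinner g g = 1 \<and>
    (\<forall>f x. multiplier ev f \<longrightarrow> x \<in> perp es \<longrightarrow> cinner (mult_op ev f x) g = f \<nu> * cinner x g)"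
proof -
  have tri: "triangular M es \<mu>s" and orth: "orthonormal_list es"
    and inv: "\<And>f x. multiplier ev f \<Longrightarrow> x \<in> perp es \<Longrightarrow> mult_op ev f x \<in> perp es"
    using flag by (auto simp: coinvariant_flag_def triangular_def)
  \<comment> \<open>Any coordinate direction will do for the line.\<close>
  obtain j :: 'd where True by blast
  define \<delta> where "\<delta> = 1 - norm \<nu>"
  have \<delta>: "\<delta> > 0" using \<nu> by (simp add: \<delta>_def)
  let ?line = "axis_line j \<nu>"
  have line: "?line t \<in> ball 0 1" if "cmod t < \<delta>" for t
    using that axis_line_in_ball by (simp add: \<delta>_def)
  define \<phi> where "\<phi> = (\<lambda>h t. ev h (?line t))"
  have hol: "\<phi> h holomorphic_on ball 0 \<delta>" for h
    unfolding \<phi>_def \<delta>_def by (rule holomorphic_on_axis_line)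
  define R where "R = (\<lambda>x. x - list_proj es x)"
  have R_perp: "R x \<in> perp es" for x unfolding R_def by (rule minus_list_proj_perp[OF orth])
  have R_fix: "R x = x" if "x \<in> perp es" for x using list_proj_perp[OF that] by (simp add: R_def)
  have R_sa: "cinner (R x) y = cinner x (R y)" for x y
    using orth_projD(3)[OF orth_proj_list_proj[OF orth]] by (simp add: R_def cinner_simps)
  \<comment> \<open>If all functions in the complement vanished along the line, the kernel functions at its points would lie in
    the span of \<open>es\<close>, and infinitely many numbers would occur on the finite diagonal.\<close>
  have "\<exists>h\<in>perp es. \<exists>k. (deriv ^^ k) (\<phi> h) 0 \<noteq> 0"
  proof (rule ccontr)
    assume "\<not> ?thesis"
    then have zero: "(deriv ^^ k) (\<phi> h) 0 = 0" if "h \<in> perp es" for h k using that by blast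
    have "t \<in> (\<lambda>i. \<mu>s ! i $ j - \<nu> $ j) ` {..<length es}" if t: "t \<in> ball 0 \<delta>" for t
    proof -
      have w: "?line t \<in> ball 0 1" using line t by simp
      have "\<phi> (R (kern (?line t))) t = 0"
        using hol t zero[OF R_perp] by (rule holomorphic_fun_eq_0_on_ball)
      then have "cinner (R (kern (?line t))) (kern (?line t)) = 0"
        using w by (simp add: \<phi>_def ev_eq_cinner)
      then have "cinner (R (kern (?line t))) (R (kern (?line t))) = 0"
        using R_sa[of "R (kern (?line t))" "kern (?line t)"] R_fix[OF R_perp] by simp
      then have "kern (?line t) = list_proj es (kern (?line t))" by (simp add: R_def)
      then have "kern (?line t) \<in> cspan (set es)" using list_proj_in_span by metis
      then obtain i where "i < length es" "\<mu>s ! i $ j = ?line t $ j"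
        using kern_in_span_coord[OF tri w] by blast
      then show ?thesis by (intro image_eqI[of _ _ i]) (auto simp: axis_line_def)
    qed
    then have "ball (0::complex) \<delta> \<subseteq> (\<lambda>i. \<mu>s ! i $ j - \<nu> $ j) ` {..<length es}" by blast
    then have "finite (ball (0::complex) \<delta>)" by (rule finite_subset) simp
    then show False using \<delta> uncountable_ball[of \<delta> "0::complex"] uncountable_infinite by blast
  qed
  then have ex: "\<exists>m. \<exists>h\<in>perp es. (deriv ^^ m) (\<phi> h) 0 \<noteq> 0" by blast
  define m where "m = (LEAST m. \<exists>h\<in>perp es. (deriv ^^ m) (\<phi> h) 0 \<noteq> 0)"
  obtain h\<^sub>0 where h\<^sub>0: "h\<^sub>0 \<in> perp es" "(deriv ^^ m) (\<phi> h\<^sub>0) 0 \<noteq> 0"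
    using LeastI_ex[OF ex] unfolding m_def by blast
  have low: "(deriv ^^ k) (\<phi> h) 0 = 0" if "k < m" "h \<in> perp es" for k h
    using not_less_Least[OF that(1)[unfolded m_def]] that(2) by blast
  \<comment> \<open>A sequence of nonzero parameters in the disc with limit \<open>0\<close>; along it the leading coefficient \<open>L\<close> is a
    pointwise limit of the functionals represented by \<open>G k\<close>, which makes it bounded.\<close>
  define s where "s = (\<lambda>k. complex_of_real (\<delta> / (of_nat k + 2)))"
  have s_ne: "s k \<noteq> 0" for k
  proof -
    have "\<delta> / (real k + 2) > 0" using \<delta> by simp
    then show ?thesis unfolding s_def of_real_eq_0_iff by (rule less_imp_neq[symmetric])
  qed
  have s_less: "cmod (s k) < \<delta>" for k
  proof -
    have "\<delta> / (real k + 2) < \<delta>" "\<delta> / (real k + 2) > 0" using \<delta> by (simp_all add: field_simps add_pos_nonneg)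
    then show ?thesis unfolding s_def norm_of_real by linarith
  qed
  have s_lim: "s \<longlonglongrightarrow> 0"
  proof -
    have "(\<lambda>k. \<delta> / (real k + 2)) \<longlonglongrightarrow> 0" by real_asymp
    from tendsto_of_real[OF this, where 'a = complex] show ?thesis unfolding s_def of_real_0 .
  qed
  define L where "L = (\<lambda>x. (deriv ^^ m) (\<phi> (R x)) 0 / fact m)"
  have L_lim: "(\<lambda>k. \<phi> (R x) (s k) / s k ^ m) \<longlonglongrightarrow> L x" for x
    unfolding L_def
  proof (rule filterlim_compose[OF holomorphic_leading_limit[OF hol \<delta>]])
    show "filterlim s (at 0) sequentially"
      using s_lim s_ne by (simp add: filterlim_at)
  qed (rule low[OF _ R_perp])
  define G where "G = (\<lambda>k. cnj (1 / s k ^ m) *\<^sub>C R (kern (?line (s k))))"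
  have G: "cinner x (G k) = \<phi> (R x) (s k) / s k ^ m" for x k
    using line[OF s_less[of k]] by (simp add: G_def cinner_simps \<phi>_def ev_eq_cinner R_sa)
  have "\<exists>C. \<forall>g\<in>range G. cmod (cinner x g) \<le> C" for x
  proof -
    have "Bseq (\<lambda>k. cinner x (G k))" unfolding G using L_lim by (intro convergent_imp_Bseq convergentI)
    then show ?thesis by (auto simp: Bseq_def)
  qed
  then obtain C where C: "C \<ge> 0" "\<And>k. norm (G k) \<le> C"
    using weakly_bounded_imp_bounded[of "range G"] by auto
  have G_lim: "(\<lambda>k. cinner x (G k)) \<longlonglongrightarrow> L x" for x unfolding G by (rule L_lim)
  have "cmod (L x) \<le> C * norm x" for x
  proof (rule tendsto_upperbound[OF tendsto_norm[OF G_lim]])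
    have "cmod (cinner x (G k)) \<le> C * norm x" for k
      using norm_cinner_le[of x "G k"] mult_left_mono[OF C(2)[of k], of "norm x"]
      by (simp add: mult.commute)
    then show "\<forall>\<^sub>F k in sequentially. cmod (cinner x (G k)) \<le> C * norm x" by simp
  qed simp
  moreover have "L (x + y) = L x + L y" for x y
    using tendsto_add[OF G_lim[of x] G_lim[of y]] G_lim[of "x + y"] LIMSEQ_unique
    by (simp add: cinner_simps)
  moreover have "L (c *\<^sub>C x) = c * L x" for c x
    using tendsto_mult_left[OF G_lim[of x], of c] G_lim[of "c *\<^sub>C x"] LIMSEQ_unique
    by (simp add: cinner_simps)
  ultimately obtain g where g: "\<And>x. x \<in> UNIV \<Longrightarrow> L x = cinner x g"
    by (rule_tac riesz_csubspace[of UNIV C L]) (simp_all add: C(1))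
  have gL: "cinner x g = L x" for x using g[of x] by simp
  have "cinner e g = 0" if e: "e \<in> set es" for e
  proof -
    have "R e = 0"
      using e list_proj_fixes[OF orth complex_vector.span_base] by (simp add: R_def)
    then have "cinner e (G k) = 0" for k
      using R_sa[of e "R (kern (?line (s k)))"] R_fix[OF R_perp]
      by (simp add: G_def cinner_simps)
    then have "(\<lambda>k. 0) \<longlonglongrightarrow> L e" using G_lim[of e] by simp
    then show ?thesis by (simp add: gL LIMSEQ_const_iff)
  qed
  then have g_perp: "g \<in> perp es" using cinner_eq_0_commute by (auto simp: perp_def)
  have "cinner h\<^sub>0 g \<noteq> 0" using h\<^sub>0 by (simp add: gL L_def R_fix)
  then have g_ne: "g \<noteq> 0" by auto
  have g_eig: "cinner (mult_op ev f x) g = f \<nu> * cinner x g"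
    if f: "multiplier ev f" and x: "x \<in> perp es" for f x
  proof -
    have ball0: "(0::complex^'d) \<in> ball 0 1" by simp
    \<comment> \<open>A multiplier is its own product with the constant function \<^term>\<open>kern 0\<close>, hence continuous.\<close>
    have f_ev: "f z = ev (mult_op ev f (kern 0)) z" if "z \<in> ball 0 1" for z
      using ev_mult_op[OF f that] ev_kern[OF that ball0] by (simp add: cdot_def)
    have "(\<lambda>k. ?line (s k)) \<longlonglongrightarrow> \<nu>"
    proof -
      have "(\<lambda>k. axis j (s k) :: complex^'d) \<longlonglongrightarrow> 0"
        using s_lim by (intro tendsto_norm_zero_cancel[of "\<lambda>k. axis j (s k)"])
          (simp add: norm_axis tendsto_norm_zero)
      then show ?thesis unfolding axis_line_def using tendsto_add[OF tendsto_const] by fastforce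
    qed
    then have "(\<lambda>k. ev (mult_op ev f (kern 0)) (?line (s k))) \<longlonglongrightarrow> ev (mult_op ev f (kern 0)) \<nu>"
      by (rule isCont_tendsto_compose[OF continuous_ev[OF \<nu>]])
    then have "(\<lambda>k. f (?line (s k))) \<longlonglongrightarrow> f \<nu>" using f_ev line[OF s_less] \<nu> by simp
    then have "(\<lambda>k. f (?line (s k)) * (\<phi> (R x) (s k) / s k ^ m)) \<longlonglongrightarrow> f \<nu> * L x"
      using L_lim by (rule tendsto_mult)
    moreover have "f (?line (s k)) * (\<phi> (R x) (s k) / s k ^ m)
        = \<phi> (R (mult_op ev f x)) (s k) / s k ^ m" for k
      using ev_mult_op[OF f line[OF s_less[of k]], of x]
      by (simp add: R_fix x inv[OF f x] \<phi>_def)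
    ultimately have "(\<lambda>k. \<phi> (R (mult_op ev f x)) (s k) / s k ^ m) \<longlonglongrightarrow> f \<nu> * L x"
      by (simp only:)
    then have "L (mult_op ev f x) = f \<nu> * L x" by (rule LIMSEQ_unique[OF L_lim])
    then show ?thesis by (simp add: gL)
  qed
  define u where "u = complex_of_real (1 / norm g) *\<^sub>C g"
  have "csubspace (perp es)" by (auto simp: perp_def complex_vector.subspace_def cinner_simps)
  then have "u \<in> perp es" "cinner u u = 1" unfolding u_def using unit_multiple g_perp g_ne by blast+
  moreover have "cinner (mult_op ev f x) u = f \<nu> * cinner x u"
    if "multiplier ev f" "x \<in> perp es" for f x
    using g_eig[OF that] by (simp add: u_def cinner_simps)
  ultimately show ?thesis by blast
qed

text \<open>The new vector goes first: the images \<open>M j g\<close> stay in \<^term>\<open>perp es\<close>, so the matrix entries that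
triangularity requires to vanish do.\<close>

lemma coinvariant_flag_Cons:
  assumes flag: "coinvariant_flag es \<mu>s" and \<nu>: "\<nu> \<in> ball 0 1"
  shows "\<exists>g. coinvariant_flag (g # es) (\<nu> # \<mu>s)"
proof -
  obtain g where g: "g \<in> perp es" "cinner g g = 1"
    "\<And>f x. multiplier ev f \<Longrightarrow> x \<in> perp es \<Longrightarrow> cinner (mult_op ev f x) g = f \<nu> * cinner x g"
    using extension_vector[OF assms] by blast
  have tri: "triangular M es \<mu>s"
    and inv: "\<And>f x. multiplier ev f \<Longrightarrow> x \<in> perp es \<Longrightarrow> mult_op ev f x \<in> perp es"
    using flag by (auto simp: coinvariant_flag_def)
  have "triangular M (g # es) (\<nu> # \<mu>s)"
  proof (rule triangular_Cons[OF tri g(2)])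
    show "cinner g e = 0" if "e \<in> set es" for e using g(1) that by (simp add: perp_def)
    show "cinner (M j g) g = \<nu> $ j" for j using g(3)[OF multiplier_coord g(1)] g(2) by simp
    show "cinner (M j g) e = 0" if "e \<in> set es" for j e
      using inv[OF multiplier_coord g(1), of j] that by (simp add: perp_def)
  qed
  moreover have "mult_op ev f x \<in> perp (g # es)" if f: "multiplier ev f" and x: "x \<in> perp (g # es)" for f x
  proof -
    have "x \<in> perp es" "cinner x g = 0" using x by (auto simp: perp_def)
    then show ?thesis using inv[OF f] g(3)[OF f] by (auto simp: perp_def)
  qed
  ultimately show ?thesis unfolding coinvariant_flag_def by blast
qed

lemma exists_coinvariant_flag: "set \<mu>s \<subseteq> ball 0 1 \<Longrightarrow> \<exists>es. coinvariant_flag es \<mu>s"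
proof (induction \<mu>s)
  case Nil
  show ?case
    by (rule exI[of _ "[]"]) (simp add: coinvariant_flag_def triangular_def orthonormal_list_def perp_def)
next
  case (Cons \<mu> \<mu>s)
  then show ?case using coinvariant_flag_Cons by fastforce
qed

lemma Psi_surj:
  assumes X: "X \<in> sym_polyball n"
  shows "X \<in> Psi ev ` coinvariant_projections ev n"
proof -
  obtain \<mu>s where \<mu>s: "mset \<mu>s = X" by (metis ex_mset)
  then obtain es where flag: "coinvariant_flag es \<mu>s"
    using exists_coinvariant_flag[of \<mu>s] X by (auto simp: sym_polyball_def)
  then have tri: "triangular M es \<mu>s" and orth: "orthonormal_list es"
    by (auto simp: coinvariant_flag_def triangular_def)
  have op: "orth_proj (list_proj es)" by (rule orth_proj_list_proj[OF orth])
  have "bounded_linear (list_proj es)"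
    by (rule bounded_linear_clinear[OF clinear_list_proj, of es 1]) (simp add: norm_orth_proj_le[OF op])
  then obtain P where P: "blinfun_apply P = list_proj es" by (metis bounded_linear_Blinfun_apply)
  have range: "range P = cspan (set es)" by (simp add: P range_list_proj[OF orth])
  have len: "length es = n"
    using tri X \<mu>s by (auto simp: triangular_def sym_polyball_def)
  have "P \<in> coinvariant_projections ev n"
  proof (rule coinvariant_projectionsI)
    show "orth_proj (blinfun_apply P)" by (simp add: P op)
    show "cdim (range P) = n" unfolding range cdim_orthonormal[OF orth] by (rule len)
    fix f x assume f: "multiplier ev f"
    have "mult_op ev f (x - list_proj es x) \<in> perp es"
      using flag f minus_list_proj_perp[OF orth] by (auto simp: coinvariant_flag_def)
    then have "list_proj es (mult_op ev f (x - list_proj es x)) = 0" by (rule list_proj_perp)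
    then show "P (mult_op ev f (P x)) = P (mult_op ev f x)"
      by (simp add: P clinear_diff[OF clinear_mult_op[OF f]] clinear_diff[OF clinear_list_proj])
  qed
  moreover from this have "Psi ev P = X" using Psi_triangular(1) tri range \<mu>s by metis
  ultimately show ?thesis by blast
qed

end

theorem theorem3p6:
  fixes ev :: "'h::complex_hilbert \<Rightarrow> complex^'d \<Rightarrow> complex" and n :: nat
  assumes "drury_arveson ev" and "n \<ge> 1"
  shows "Psi ev ` coinvariant_projections ev n = sym_polyball n \<and>
    continuous_map (top_of_set (coinvariant_projections ev n)) (sym_polyball_topology n) (Psi ev)"
proof -
  interpret drury_arveson_space ev by unfold_locales (rule assms(1))
  show ?thesis using Psi_in_sym_polyball[OF _ assms(2)] Psi_surj continuous_Psi[OF assms(2)] by blast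
qed

end
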